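(* Let $0<p<1/2$ and let the sequence $\{q_k:k\in\mathbb N\}$ be non-decreasing. Then the maximal operator $$\widetilde t_{p,1}^{\,*}f:=\sup_{n\in\mathbb N_+}\frac{|t_nf|}{(n+1)^{1/p-2}}$$ is bounded from the martingale Hardy space $H_p$ to the Lebesgue space $L_p$.
   Context: $\mathbb N_+$ is the set of positive integers, $\mathbb N=\mathbb N_+\cup\{0\}$. Fix a bounded sequence $m=(m_0,m_1,\dots)$ of integers $m_k\ge 2$. $G_m=\prod_{k\ge0}Z_{m_k}$, where $Z_{m_k}=\{0,\dots,m_k-1\}$ is the additive group modulo $m_k$, with the product of the discrete topologies; $\mu$ is the Haar measure with $\mu(G_m)=1$. $M_0:=1$, $M_{k+1}:=m_kM_k$; every $n\in\mathbb N$ is uniquely $n=\sum_{j\ge0}n_jM_j$ with $n_j\in Z_{m_j}$. $r_k(x):=\exp(2\pi i x_k/m_k)$, $\psi_n:=\prod_{k\ge0}r_k^{n_k}$ (Vilenkin system). $I_0(x):=G_m$, $I_n(x):=\{y: y_0=x_0,\dots,y_{n-1}=x_{n-1}\}$; $\mathcal F_n$ is the $\sigma$-algebra generated by $\{I_n(x):x\in G_m\}$. For $g\in L_1(G_m)$: $\widehat g(k):=\int g\overline{\psi_k}\,d\mu$, $S_ng:=\sum_{k=0}^{n-1}\widehat g(k)\psi_k$. A martingale is a sequence $f=(f^{(n)}:n\in\mathbb N)$ of integrable functions with $f^{(n)}$ $\mathcal F_n$-measurable and $S_{M_n}f^{(k)}=f^{(n)}$ for $n\le k$; $f^*:=\sup_n|f^{(n)}|$;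 $H_p$ is the set of martingales with $\|f\|_{H_p}:=\|f^*\|_p<\infty$, where $\|g\|_p:=(\int|g|^pd\mu)^{1/p}$. For a martingale, $\widehat f(i):=\lim_k\int f^{(k)}\overline{\psi_i}\,d\mu$ and $S_nf:=\sum_{k=0}^{n-1}\widehat f(k)\psi_k$. For a sequence $\{q_k:k\in\mathbb N\}$ of nonnegative numbers, $Q_n:=\sum_{k=0}^{n-1}q_k$ and the Nörlund means are $t_nf:=\frac1{Q_n}\sum_{k=1}^nq_{n-k}S_kf$ ($n\in\mathbb N_+$); it is always assumed that $q_0>0$ and $Q_n\to\infty$. An operator $T$ is bounded from $H_p$ to $L_p$ if there is a constant $C$ with $\|Tf\|_p\le C\|f\|_{H_p}$ for all $f\in H_p$. *)

theory Defs
  imports "HOL-Probability.Probability"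
begin

section \<open>The Vilenkin group\<close>

text \<open>
  Elements of \<open>G\<^sub>m\<close> are functions \<open>x :: nat \<Rightarrow> nat\<close> with \<open>x k < m k\<close>.  The normalised Haar measure
  is constructed as the product of the uniform distributions on the factors
  \<open>{0, \<dots>, m k - 1}\<close>; lemma \<open>normalized_haar_iff\<close> below shows that this is the only translation
  invariant Borel probability measure on the compact group \<open>G\<^sub>m\<close>.
\<close>

definition vgroup :: "(nat \<Rightarrow> nat) \<Rightarrow> (nat \<Rightarrow> nat) measure" where
  "vgroup m = PiM UNIV (\<lambda>k. uniform_count_measure {..<m k})"

definition vtopology :: "(nat \<Rightarrow> nat) \<Rightarrow> (nat \<Rightarrow> nat) topology" where
  "vtopology m = product_topology (\<lambda>k. discrete_topology {..<m k}) UNIV"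

definition vadd :: "(nat \<Rightarrow> nat) \<Rightarrow> (nat \<Rightarrow> nat) \<Rightarrow> (nat \<Rightarrow> nat) \<Rightarrow> (nat \<Rightarrow> nat)" where
  "vadd m a x = (\<lambda>k. (a k + x k) mod m k)"

definition normalized_haar :: "(nat \<Rightarrow> nat) \<Rightarrow> (nat \<Rightarrow> nat) measure \<Rightarrow> bool" where
  "normalized_haar m \<mu> \<longleftrightarrow>
     sets \<mu> = sigma_sets (topspace (vtopology m)) {U. openin (vtopology m) U} \<and>
     emeasure \<mu> (space \<mu>) = 1 \<and>
     (\<forall>a \<in> topspace (vtopology m). \<forall>A \<in> sets \<mu>. emeasure \<mu> (vadd m a ` A) = emeasure \<mu> A)"

definition vint :: "(nat \<Rightarrow> nat) \<Rightarrow> nat \<Rightarrow> (nat \<Rightarrow> nat) \<Rightarrow> (nat \<Rightarrow> nat) set" where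
  "vint m n x = {y \<in> space (vgroup m). \<forall>j<n. y j = x j}"

definition vfiltration :: "(nat \<Rightarrow> nat) \<Rightarrow> nat \<Rightarrow> (nat \<Rightarrow> nat) measure" where
  "vfiltration m n = sigma (space (vgroup m)) {vint m n x | x. x \<in> space (vgroup m)}"


section \<open>The Vilenkin system and Fourier series\<close>

primrec vbase :: "(nat \<Rightarrow> nat) \<Rightarrow> nat \<Rightarrow> nat" where
  "vbase m 0 = 1"
| "vbase m (Suc k) = m k * vbase m k"

text \<open>
  The mixed radix digits of \<open>n\<close>; see \<open>vdigit_expansion\<close> and \<open>vdigit_unique\<close> below.
\<close>

definition vdigit :: "(nat \<Rightarrow> nat) \<Rightarrow> nat \<Rightarrow> nat \<Rightarrow> nat" where
  "vdigit m n j = (n div vbase m j) mod m j"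

definition rademacher :: "(nat \<Rightarrow> nat) \<Rightarrow> nat \<Rightarrow> (nat \<Rightarrow> nat) \<Rightarrow> complex" where
  "rademacher m k x = exp (2 * of_real pi * \<i> * of_nat (x k) / of_nat (m k))"

definition vilenkin :: "(nat \<Rightarrow> nat) \<Rightarrow> nat \<Rightarrow> (nat \<Rightarrow> nat) \<Rightarrow> complex" where
  "vilenkin m n x = (\<Prod>k. rademacher m k x ^ vdigit m n k)"

definition fourier_coeff :: "(nat \<Rightarrow> nat) \<Rightarrow> ((nat \<Rightarrow> nat) \<Rightarrow> complex) \<Rightarrow> nat \<Rightarrow> complex" where
  "fourier_coeff m g k = (LINT x|vgroup m. g x * cnj (vilenkin m k x))"

definition fourier_sum ::
    "(nat \<Rightarrow> nat) \<Rightarrow> nat \<Rightarrow> ((nat \<Rightarrow> nat) \<Rightarrow> complex) \<Rightarrow> (nat \<Rightarrow> nat) \<Rightarrow> complex" where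
  "fourier_sum m n g x = (\<Sum>k<n. fourier_coeff m g k * vilenkin m k x)"


section \<open>Martingales, Hardy spaces and Lebesgue spaces\<close>

type_synonym vsequence = "nat \<Rightarrow> (nat \<Rightarrow> nat) \<Rightarrow> complex"

definition vmartingale :: "(nat \<Rightarrow> nat) \<Rightarrow> vsequence \<Rightarrow> bool" where
  "vmartingale m f \<longleftrightarrow>
     (\<forall>n. integrable (vgroup m) (f n)) \<and>
     (\<forall>n. f n \<in> borel_measurable (vfiltration m n)) \<and>
     (\<forall>n k. n \<le> k \<longrightarrow> (\<forall>x \<in> space (vgroup m). fourier_sum m (vbase m n) (f k) x = f n x))"

definition martingale_coeff :: "(nat \<Rightarrow> nat) \<Rightarrow> vsequence \<Rightarrow> nat \<Rightarrow> complex" where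
  "martingale_coeff m f i = lim (\<lambda>k. fourier_coeff m (f k) i)"

definition martingale_sum ::
    "(nat \<Rightarrow> nat) \<Rightarrow> nat \<Rightarrow> vsequence \<Rightarrow> (nat \<Rightarrow> nat) \<Rightarrow> complex" where
  "martingale_sum m n f x = (\<Sum>k<n. martingale_coeff m f k * vilenkin m k x)"

text \<open>
  Maximal functions may take the value \<open>\<infinity>\<close>, so they are \<open>ennreal\<close>-valued, and so are the
  \<open>L\<^sub>p\<close> quasi-norms; \<open>ennreal_powr a p\<close> is \<open>a\<^sup>p\<close> for \<open>p > 0\<close>.
\<close>

definition ennreal_powr :: "ennreal \<Rightarrow> real \<Rightarrow> ennreal" where
  "ennreal_powr a p = (if a = \<infinity> then \<infinity> else ennreal (enn2real a powr p))"

definition Lp_norm :: "(nat \<Rightarrow> nat) \<Rightarrow> real \<Rightarrow> ((nat \<Rightarrow> nat) \<Rightarrow> ennreal) \<Rightarrow> ennreal" where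
  "Lp_norm m p g = ennreal_powr (\<integral>\<^sup>+x. ennreal_powr (g x) p \<partial>vgroup m) (1 / p)"

definition martingale_max :: "vsequence \<Rightarrow> (nat \<Rightarrow> nat) \<Rightarrow> ennreal" where
  "martingale_max f x = (SUP n. ennreal (cmod (f n x)))"

definition Hp_norm :: "(nat \<Rightarrow> nat) \<Rightarrow> real \<Rightarrow> vsequence \<Rightarrow> ennreal" where
  "Hp_norm m p f = Lp_norm m p (martingale_max f)"

definition Hp_space :: "(nat \<Rightarrow> nat) \<Rightarrow> real \<Rightarrow> vsequence set" where
  "Hp_space m p = {f. vmartingale m f \<and> Hp_norm m p f < \<infinity>}"

text \<open>
  The operators considered are nonnegative (maximal) operators, whence the \<open>ennreal\<close>-valued
  \<open>T f\<close>; a real function \<open>|T f|\<close> embeds via \<open>ennreal\<close>.  Measurability of \<open>T f\<close> is part of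
  \<open>T f \<in> L\<^sub>p\<close>, and finiteness of its quasi-norm follows from the inequality.
\<close>

definition bounded_Hp_Lp ::
    "(nat \<Rightarrow> nat) \<Rightarrow> real \<Rightarrow> (vsequence \<Rightarrow> (nat \<Rightarrow> nat) \<Rightarrow> ennreal) \<Rightarrow> bool" where
  "bounded_Hp_Lp m p T \<longleftrightarrow>
     (\<exists>C::real. 0 \<le> C \<and> (\<forall>f \<in> Hp_space m p.
        T f \<in> borel_measurable (vgroup m) \<and> Lp_norm m p (T f) \<le> ennreal C * Hp_norm m p f))"


section \<open>Noerlund means\<close>

definition norlund_weight :: "(nat \<Rightarrow> real) \<Rightarrow> nat \<Rightarrow> real" where
  "norlund_weight q n = (\<Sum>k<n. q k)"

definition norlund_mean ::
    "(nat \<Rightarrow> nat) \<Rightarrow> (nat \<Rightarrow> real) \<Rightarrow> nat \<Rightarrow> vsequence \<Rightarrow> (nat \<Rightarrow> nat) \<Rightarrow> complex" where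
  "norlund_mean m q n f x =
     (\<Sum>k=1..n. of_real (q (n - k)) * martingale_sum m k f x) / of_real (norlund_weight q n)"


section \<open>The digits and the Haar measure are the right ones\<close>

lemma vbase_gt:
  assumes "\<And>k. 2 \<le> m k"
  shows "n < vbase m n"
proof (induction n)
  case (Suc n)
  have "2 * vbase m n \<le> m n * vbase m n" by (rule mult_right_mono[OF assms]) simp
  with Suc show ?case unfolding vbase.simps by linarith
qed simp

lemma vbase_pos:
  assumes "\<And>k. 2 \<le> m k"
  shows "0 < vbase m n"
  using vbase_gt[of m n, OF assms] by linarith

lemma vbase_dvd: "i \<le> j \<Longrightarrow> vbase m i dvd vbase m j"
proof (induction j)
  case (Suc j)
  then show ?case by (cases "i = Suc j") (auto simp: le_Suc_eq)
qed simp

lemma vdigit_less: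
  assumes "\<And>k. 2 \<le> m k"
  shows "vdigit m n k < m k"
proof -
  have "0 < m k" using assms[of k] by linarith
  then show ?thesis by (simp add: vdigit_def)
qed

lemma vdigit_sum: "(\<Sum>j<N. vdigit m n j * vbase m j) = n mod vbase m N"
proof (induction N)
  case (Suc N)
  have "n mod (vbase m N * m N) = vbase m N * (n div vbase m N mod m N) + n mod vbase m N"
    by (rule mod_mult2_eq)
  with Suc show ?case by (simp add: vdigit_def mult.commute)
qed simp

lemma vdigit_zero:
  assumes "\<And>k. 2 \<le> m k" and "n \<le> j"
  shows "vdigit m n j = 0"
proof -
  have "n < vbase m j" using vbase_gt[of m j, OF assms(1)] assms(2) by linarith
  then show ?thesis by (simp add: vdigit_def)
qed

lemma vdigit_expansion:
  assumes "\<And>k. 2 \<le> m k"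
  shows "finite {j. vdigit m n j \<noteq> 0}"
    and "n = (\<Sum>j | vdigit m n j \<noteq> 0. vdigit m n j * vbase m j)"
proof -
  have sub: "{j. vdigit m n j \<noteq> 0} \<subseteq> {..<n}"
    using vdigit_zero[of m n, OF assms] by (metis (mono_tags) lessThan_iff mem_Collect_eq not_le subsetI)
  then show "finite {j. vdigit m n j \<noteq> 0}" by (rule finite_subset) simp
  have "(\<Sum>j | vdigit m n j \<noteq> 0. vdigit m n j * vbase m j) = (\<Sum>j<n. vdigit m n j * vbase m j)"
    by (rule sum.mono_neutral_left) (use sub in auto)
  also have "\<dots> = n" using vbase_gt[of m n, OF assms] by (simp add: vdigit_sum)
  finally show "n = (\<Sum>j | vdigit m n j \<noteq> 0. vdigit m n j * vbase m j)" by simp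
qed

lemma vdigit_unique:
  assumes m: "\<And>k. 2 \<le> m k" and d: "\<And>j. d j < m j" and fin: "finite {j. d j \<noteq> 0}"
    and n: "n = (\<Sum>j | d j \<noteq> 0. d j * vbase m j)"
  shows "vdigit m n = d"
proof
  fix i
  obtain N where N: "{j. d j \<noteq> 0} \<subseteq> {..<N}"
    using fin finite_nat_iff_bounded by blast
  define K where "K = max N (Suc i)"
  have less: "(\<Sum>j<k. d j * vbase m j) < vbase m k" for k
  proof (induction k)
    case (Suc k)
    have "(d k + 1) * vbase m k \<le> m k * vbase m k" using d[of k] by (intro mult_right_mono) auto
    with Suc show ?case by (simp add: algebra_simps)
  qed simp
  have "n = (\<Sum>j<K. d j * vbase m j)"
    unfolding n by (rule sum.mono_neutral_left) (use N in \<open>auto simp: K_def\<close>)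
  also have "{..<K} = {..<i} \<union> {i} \<union> {Suc i..<K}" by (auto simp: K_def)
  also have "(\<Sum>j\<in>\<dots>. d j * vbase m j) =
      (\<Sum>j<i. d j * vbase m j) + d i * vbase m i + (\<Sum>j\<in>{Suc i..<K}. d j * vbase m j)"
    by (subst sum.union_disjoint; (subst sum.union_disjoint)?) auto
  finally have n': "n = (\<Sum>j<i. d j * vbase m j) + d i * vbase m i
      + (\<Sum>j\<in>{Suc i..<K}. d j * vbase m j)" .
  have "vbase m (Suc i) dvd (\<Sum>j\<in>{Suc i..<K}. d j * vbase m j)"
    by (intro dvd_sum dvd_mult vbase_dvd) auto
  then obtain c where c: "(\<Sum>j\<in>{Suc i..<K}. d j * vbase m j) = vbase m (Suc i) * c" by (elim dvdE)
  have n'': "n = (\<Sum>j<i. d j * vbase m j) + vbase m i * (d i + m i * c)"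
    using n' c by (simp add: algebra_simps)
  have "n div vbase m i = d i + m i * c"
    unfolding n'' using vbase_pos[of m i, OF m] less[of i] by simp
  then show "vdigit m n i = d i" using d[of i] by (simp add: vdigit_def)
qed

lemma vilenkin_eq_prod:
  assumes "\<And>k. 2 \<le> m k"
  shows "vilenkin m n x = (\<Prod>k | vdigit m n k \<noteq> 0. rademacher m k x ^ vdigit m n k)"
  unfolding vilenkin_def by (rule prodinf_finite) (use vdigit_expansion(1)[of m n, OF assms] in auto)

lemma space_vgroup: "space (vgroup m) = {x. \<forall>k. x k < m k}"
  by (auto simp: vgroup_def space_PiM space_uniform_count_measure PiE_def Pi_def)

lemma topspace_vtopology: "topspace (vtopology m) = space (vgroup m)"
  by (auto simp: space_vgroup vtopology_def PiE_def Pi_def)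

lemma vint_sets: "vint m n x \<in> sets (vgroup m)"
proof -
  have meas: "(\<lambda>y. y j) \<in> measurable (vgroup m) (uniform_count_measure {..<m j})" for j
    unfolding vgroup_def by (rule measurable_component_singleton) simp
  have sets: "{y \<in> space (vgroup m). y j = c} \<in> sets (vgroup m)" for j c
  proof -
    have "(\<lambda>y. y j) -` ({c} \<inter> {..<m j}) \<inter> space (vgroup m) \<in> sets (vgroup m)"
      by (rule measurable_sets[OF meas]) (simp add: sets_uniform_count_measure)
    also have "(\<lambda>y. y j) -` ({c} \<inter> {..<m j}) \<inter> space (vgroup m) = {y \<in> space (vgroup m). y j = c}"
      by (auto simp: space_vgroup)
    finally show ?thesis .
  qed
  have "{y \<in> space (vgroup m). \<forall>j\<in>{..<n}. y j = x j} \<in> sets (vgroup m)"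
    by (rule sets.sets_Collect_finite_All) (auto intro: sets)
  then show ?thesis unfolding vint_def Ball_def lessThan_iff .
qed

definition vbasis :: "(nat \<Rightarrow> nat) \<Rightarrow> (nat \<Rightarrow> nat) set set" where
  "vbasis m = insert {} {vint m n x | n x. x \<in> space (vgroup m)}"

lemma countable_vbasis: "countable (vbasis m)"
proof -
  have "vbasis m \<subseteq> insert {} (range (\<lambda>xs::nat list. {y \<in> space (vgroup m). \<forall>j<length xs. y j = xs ! j}))"
    (is "_ \<subseteq> insert _ (range ?g)")
  proof -
    have "vint m n x \<in> range ?g" for n x
      by (rule image_eqI[of _ _ "map x [0..<n]"]) (auto simp: vint_def)
    then show ?thesis unfolding vbasis_def by blast
  qed
  then show ?thesis by (rule countable_subset) simp
qed

lemma open_in_sigma_vbasis: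
  assumes "openin (vtopology m) U"
  shows "U \<in> sigma_sets (space (vgroup m)) (vbasis m)"
proof -
  have ex: "\<exists>n. vint m n x \<subseteq> U" if x: "x \<in> U" for x
  proof -
    obtain X where X: "x \<in> (\<Pi>\<^sub>E i\<in>UNIV. X i)" "finite {i. X i \<noteq> {..<m i}}" "(\<Pi>\<^sub>E i\<in>UNIV. X i) \<subseteq> U"
      using product_topology_open_contains_basis[OF assms[unfolded vtopology_def] x] by auto
    obtain N where N: "{i. X i \<noteq> {..<m i}} \<subseteq> {..<N}"
      using X(2) finite_nat_iff_bounded by blast
    have "vint m N x \<subseteq> (\<Pi>\<^sub>E i\<in>UNIV. X i)"
    proof
      fix y assume y: "y \<in> vint m N x"
      have "y i \<in> X i" for i
      proof (cases "i < N")
        case True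
        then show ?thesis using y X(1) by (auto simp: vint_def PiE_def Pi_def)
      next
        case False
        then have "X i = {..<m i}" using N by auto
        then show ?thesis using y by (auto simp: vint_def space_vgroup)
      qed
      then show "y \<in> (\<Pi>\<^sub>E i\<in>UNIV. X i)" by auto
    qed
    with X(3) show ?thesis by blast
  qed
  have sub: "U \<subseteq> space (vgroup m)"
    using openin_subset[OF assms] by (simp add: topspace_vtopology)
  have "U \<subseteq> \<Union>{b \<in> vbasis m. b \<subseteq> U}"
  proof
    fix x assume x: "x \<in> U"
    obtain n where "vint m n x \<subseteq> U" using ex[OF x] by (elim exE)
    moreover have "x \<in> space (vgroup m)" using x sub by (rule subsetD[rotated])
    then have "vint m n x \<in> vbasis m" "x \<in> vint m n x" by (auto simp: vbasis_def vint_def)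
    ultimately show "x \<in> \<Union>{b \<in> vbasis m. b \<subseteq> U}" by (intro UnionI[of "vint m n x"]) simp_all
  qed
  then have eq: "\<Union>{b \<in> vbasis m. b \<subseteq> U} = U" by (intro equalityI) auto
  have "\<Union>{b \<in> vbasis m. b \<subseteq> U} \<in> sigma_sets (space (vgroup m)) (vbasis m)"
    by (rule sigma_sets_UNION) (auto intro: countable_subset[OF _ countable_vbasis])
  then show ?thesis unfolding eq .
qed

lemma vbasis_sets: "vbasis m \<subseteq> sets (vgroup m)"
  by (auto simp: vbasis_def vint_sets)

lemma sets_vgroup_sub: "sets (vgroup m) \<subseteq> sigma_sets (space (vgroup m)) {U. openin (vtopology m) U}"
proof -
  have op: "openin (vtopology m) {f \<in> space (vgroup m). f i \<in> A}" if "A \<subseteq> {..<m i}" for i A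
    using openin_continuous_map_preimage[OF continuous_map_product_projection[of i UNIV
          "\<lambda>k. discrete_topology {..<m k}"], of A] that
    by (simp add: vtopology_def[symmetric] topspace_vtopology)
  have sp: "(\<Pi>\<^sub>E i\<in>UNIV. space (uniform_count_measure {..<m i})) = space (vgroup m)"
    by (simp add: vgroup_def space_PiM)
  show ?thesis
    unfolding vgroup_def sets_PiM_single
    unfolding sp vgroup_def[symmetric]
    by (rule sigma_sets_mono') (auto simp: sets_uniform_count_measure intro!: op)
qed

lemma sets_vgroup_vbasis: "sets (vgroup m) = sigma_sets (space (vgroup m)) (vbasis m)"
  and sets_vgroup_borel: "sets (vgroup m) = sigma_sets (space (vgroup m)) {U. openin (vtopology m) U}"
proof -
  have 1: "sigma_sets (space (vgroup m)) {U. openin (vtopology m) U} \<subseteq> sigma_sets (space (vgroup m)) (vbasis m)"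
    by (rule sigma_sets_mono) (auto intro: open_in_sigma_vbasis)
  have 2: "sigma_sets (space (vgroup m)) (vbasis m) \<subseteq> sets (vgroup m)"
    by (rule sets.sigma_sets_subset[OF vbasis_sets])
  show "sets (vgroup m) = sigma_sets (space (vgroup m)) (vbasis m)"
    by (rule equalityI[OF order_trans[OF sets_vgroup_sub 1] 2])
  show "sets (vgroup m) = sigma_sets (space (vgroup m)) {U. openin (vtopology m) U}"
    by (rule equalityI[OF sets_vgroup_sub order_trans[OF 1 2]])
qed

lemma Int_stable_vbasis: "Int_stable (vbasis m)"
proof (rule Int_stableI)
  fix a b assume ab: "a \<in> vbasis m" "b \<in> vbasis m"
  have int: "vint m n x \<inter> vint m k y \<in> vbasis m"
    if xy: "x \<in> space (vgroup m)" "y \<in> space (vgroup m)" for n k x y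
  proof (cases "vint m n x \<inter> vint m k y = {}")
    case False
    then obtain z where z: "z \<in> vint m n x" "z \<in> vint m k y" by auto
    then have "vint m n x = vint m n z" "vint m k y = vint m k z"
      by (simp_all add: vint_def)
    moreover have "vint m n z \<inter> vint m k z = vint m (max n k) z"
      unfolding vint_def by (fastforce simp: less_max_iff_disj)
    ultimately have "vint m n x \<inter> vint m k y = vint m (max n k) z"
      by (simp only:)
    moreover have "z \<in> space (vgroup m)" using z by (simp add: vint_def)
    ultimately show ?thesis by (auto simp: vbasis_def)
  qed (simp add: vbasis_def)
  show "a \<inter> b \<in> vbasis m"
  proof (cases "a = {} \<or> b = {}")
    case False
    then obtain n x k y where "a = vint m n x" "b = vint m k y"
      "x \<in> space (vgroup m)" "y \<in> space (vgroup m)"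
      using ab by (auto simp: vbasis_def)
    then show ?thesis using int by simp
  qed (auto simp: vbasis_def)
qed

lemma prob_space_vgroup:
  assumes "\<And>k. 2 \<le> m k"
  shows "prob_space (vgroup m)"
proof -
  have "{..<m k} \<noteq> {}" for k using assms[of k] by (auto simp: lessThan_empty_iff)
  then show ?thesis
    unfolding vgroup_def by (intro prob_space_PiM prob_space_uniform_count_measure) auto
qed

lemma vadd_space:
  assumes "\<And>k. 2 \<le> m k"
  shows "vadd m a x \<in> space (vgroup m)"
proof -
  have "0 < m k" for k using assms[of k] by linarith
  then show ?thesis by (simp add: vadd_def space_vgroup)
qed

lemma vint_vadd:
  assumes "\<And>k. 2 \<le> m k" "x \<in> space (vgroup m)" "y \<in> space (vgroup m)"
  obtains a where "a \<in> space (vgroup m)" "vadd m a ` vint m n x = vint m n y"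
proof -
  define a where "a = vadd m y (\<lambda>k. m k - x k)"
  define b where "b = vadd m x (\<lambda>k. m k - y k)"
  have xy: "x k < m k" "y k < m k" for k using assms by (auto simp: space_vgroup)
  have 1: "vadd m a z \<in> vint m n y" if "z \<in> vint m n x" for z
  proof -
    have "vadd m a z k = y k" if "k < n" for k
    proof -
      have "z k = x k" using \<open>z \<in> vint m n x\<close> that by (simp add: vint_def)
      then have "vadd m a z k = (y k + (m k - x k) + x k) mod m k"
        by (simp add: vadd_def a_def mod_add_left_eq)
      also have "y k + (m k - x k) + x k = y k + m k" using xy[of k] by simp
      finally show ?thesis using xy[of k] by simp
    qed
    then show ?thesis using vadd_space[of m, OF assms(1)] by (simp add: vint_def)
  qed
  have 2: "vadd m b z \<in> vint m n x" if "z \<in> vint m n y" for z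
  proof -
    have "vadd m b z k = x k" if "k < n" for k
    proof -
      have "z k = y k" using \<open>z \<in> vint m n y\<close> that by (simp add: vint_def)
      then have "vadd m b z k = (x k + (m k - y k) + y k) mod m k"
        by (simp add: vadd_def b_def mod_add_left_eq)
      also have "x k + (m k - y k) + y k = x k + m k" using xy[of k] by simp
      finally show ?thesis using xy[of k] by simp
    qed
    then show ?thesis using vadd_space[of m, OF assms(1)] by (simp add: vint_def)
  qed
  have 3: "vadd m a (vadd m b z) = z" if "z \<in> vint m n y" for z
  proof
    fix k
    have z: "z k < m k" using that by (simp add: vint_def space_vgroup)
    have "vadd m a (vadd m b z) k = ((y k + (m k - x k)) + ((x k + (m k - y k)) + z k)) mod m k"
      by (simp add: vadd_def a_def b_def mod_simps)
    also have "(y k + (m k - x k)) + ((x k + (m k - y k)) + z k) = z k + m k + m k"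
      using xy[of k] by simp
    finally show "vadd m a (vadd m b z) k = z k" using z by simp
  qed
  have "vadd m a ` vint m n x = vint m n y"
    using 1 2 3 by (force simp: image_iff)
  then show ?thesis using that[of a] vadd_space[of m, OF assms(1)] by (simp add: a_def)
qed

lemma haar_vint:
  assumes m: "\<And>k. 2 \<le> m k" and haar: "normalized_haar m \<mu>" and x: "x \<in> space (vgroup m)"
  shows "emeasure \<mu> (vint m n x) = ennreal (1 / real (vbase m n))"
  using x
proof (induction n arbitrary: x)
  case 0
  have "sets \<mu> = sets (vgroup m)"
    using haar sets_vgroup_borel[of m] by (simp add: normalized_haar_def topspace_vtopology)
  then have "space \<mu> = space (vgroup m)" by (rule sets_eq_imp_space_eq)
  then show ?case using haar by (simp add: normalized_haar_def vint_def)
next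
  case (Suc n)
  have sets: "sets \<mu> = sets (vgroup m)"
    using haar sets_vgroup_borel[of m] by (simp add: normalized_haar_def topspace_vtopology)
  have mem: "x(n := c) \<in> space (vgroup m)" if "c < m n" for c
    using Suc.prems that by (simp add: space_vgroup)
  have eq: "emeasure \<mu> (vint m (Suc n) (x(n := c))) = emeasure \<mu> (vint m (Suc n) x)"
    if c: "c < m n" for c
  proof -
    obtain a where a: "a \<in> space (vgroup m)"
      and im: "vadd m a ` vint m (Suc n) x = vint m (Suc n) (x(n := c))"
      by (rule vint_vadd[of m x "x(n := c)" "Suc n", OF m Suc.prems mem[OF c]])
    have "emeasure \<mu> (vadd m a ` A) = emeasure \<mu> A" if "A \<in> sets \<mu>" for A
      using haar a that by (simp add: normalized_haar_def topspace_vtopology)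
    from this[of "vint m (Suc n) x"] show ?thesis by (simp add: im sets vint_sets)
  qed
  have mem_iff: "y \<in> vint m (Suc n) (x(n := c)) \<longleftrightarrow> y \<in> vint m n x \<and> y n = c" for c y
    unfolding vint_def less_Suc_eq by auto
  have "y n < m n" if "y \<in> vint m n x" for y
    using that by (simp add: vint_def space_vgroup)
  then have "vint m n x = (\<Union>c<m n. vint m (Suc n) (x(n := c)))"
    unfolding set_eq_iff UN_iff mem_iff by blast
  then have "emeasure \<mu> (vint m n x) = emeasure \<mu> (\<Union>c<m n. vint m (Suc n) (x(n := c)))"
    by simp
  also have "\<dots> = (\<Sum>c<m n. emeasure \<mu> (vint m (Suc n) (x(n := c))))"
  proof (rule sum_emeasure[symmetric])
    show "disjoint_family_on (\<lambda>c. vint m (Suc n) (x(n := c))) {..<m n}"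
      unfolding disjoint_family_on_def disjoint_iff mem_iff by blast
  qed (auto simp: sets vint_sets)
  also have "\<dots> = of_nat (m n) * emeasure \<mu> (vint m (Suc n) x)"
    by (simp add: eq)
  finally have *: "of_nat (m n) * emeasure \<mu> (vint m (Suc n) x) = ennreal (1 / real (vbase m n))"
    using Suc.IH[OF Suc.prems] by simp
  have pos: "0 < m n" "0 < vbase m n" using m[of n] vbase_pos[of m n, OF m] by linarith+
  have fin: "emeasure \<mu> (vint m (Suc n) x) \<noteq> \<infinity>"
  proof
    assume "emeasure \<mu> (vint m (Suc n) x) = \<infinity>"
    with * pos show False by (simp add: ennreal_mult_top)
  qed
  then obtain r where r: "r \<ge> 0" "emeasure \<mu> (vint m (Suc n) x) = ennreal r"
    by (cases "emeasure \<mu> (vint m (Suc n) x)") auto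
  have "ennreal (real (m n) * r) = ennreal (1 / real (vbase m n))"
    using * r pos by (simp add: ennreal_mult ennreal_of_nat_eq_real_of_nat)
  then have "real (m n) * r = 1 / real (vbase m n)"
    using r pos by (subst (asm) ennreal_inj) auto
  then have "r = 1 / real (vbase m (Suc n))" using pos by (simp add: field_simps)
  then show ?case using r by simp
qed

lemma vgroup_haar:
  assumes m: "\<And>k. 2 \<le> m k"
  shows "normalized_haar m (vgroup m)"
proof -
  have pos: "0 < m k" for k using m[of k] by linarith
  interpret P: prob_space "vgroup m" by (rule prob_space_vgroup[of m, OF m])
  have vint: "emeasure (vgroup m) (vint m n x) = (\<Prod>j<n. 1 / of_nat (m j))"
    if x: "x \<in> space (vgroup m)" for n x
  proof -
    have prob: "prob_space (uniform_count_measure {..<m k})" for k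
      using pos[of k] by (intro prob_space_uniform_count_measure) auto
    have "vint m n x = prod_emb UNIV (\<lambda>k. uniform_count_measure {..<m k}) {..<n} (\<Pi>\<^sub>E j\<in>{..<n}. {x j})"
      by (auto simp: vint_def vgroup_def prod_emb_def space_PiM)
    also have "emeasure (vgroup m) \<dots> = (\<Prod>j<n. emeasure (uniform_count_measure {..<m j}) {x j})"
      unfolding vgroup_def using x prob
      by (intro emeasure_PiM_emb) (auto simp: sets_uniform_count_measure space_vgroup)
    also have "\<dots> = (\<Prod>j<n. 1 / of_nat (m j))"
      using x pos by (intro prod.cong refl)
        (auto simp: emeasure_uniform_count_measure space_vgroup divide_ennreal
          ennreal_of_nat_eq_real_of_nat simp flip: ennreal_1)
    finally show ?thesis .
  qed
  have pre: "vadd m a -` vint m n x \<inter> space (vgroup m) = vint m n (vadd m (\<lambda>k. m k - a k) x)"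
    if a: "a \<in> space (vgroup m)" and x: "x \<in> space (vgroup m)" for a x n
  proof -
    have "(a k + y k) mod m k = x k \<longleftrightarrow> y k = ((m k - a k) + x k) mod m k"
      if y: "y \<in> space (vgroup m)" for y k
    proof -
      have *: "a k < m k" "x k < m k" "y k < m k" using a x y by (auto simp: space_vgroup)
      show ?thesis
      proof
        assume "(a k + y k) mod m k = x k"
        then have "((m k - a k) + x k) mod m k = ((m k - a k) + (a k + y k)) mod m k"
          by (metis mod_add_right_eq)
        also have "(m k - a k) + (a k + y k) = m k + y k" using * by simp
        finally show "y k = ((m k - a k) + x k) mod m k" using * by simp
      next
        assume "y k = ((m k - a k) + x k) mod m k"
        then have "(a k + y k) mod m k = (a k + ((m k - a k) + x k)) mod m k"
          by (metis mod_add_right_eq)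
        also have "a k + ((m k - a k) + x k) = m k + x k" using * by simp
        finally show "(a k + y k) mod m k = x k" using * by simp
      qed
    qed
    then have "vadd m a y k = x k \<longleftrightarrow> y k = vadd m (\<lambda>k. m k - a k) x k"
      if "y \<in> space (vgroup m)" for y k
      using that by (simp add: vadd_def)
    then show ?thesis using vadd_space[of m a, OF m] by (auto simp: vint_def)
  qed
  have meas: "vadd m a \<in> measurable (vgroup m) (vgroup m)" if a: "a \<in> space (vgroup m)" for a
  proof (rule measurable_sigma_sets[OF sets_vgroup_vbasis])
    show "vbasis m \<subseteq> Pow (space (vgroup m))" by (auto simp: vbasis_def vint_def)
    show "vadd m a \<in> space (vgroup m) \<rightarrow> space (vgroup m)" using vadd_space[of m, OF m] by auto
    fix A assume "A \<in> vbasis m"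
    then show "vadd m a -` A \<inter> space (vgroup m) \<in> sets (vgroup m)"
      by (auto simp: vbasis_def pre[OF a] vint_sets)
  qed
  have z: "(\<lambda>_. 0) \<in> space (vgroup m)" using pos by (simp add: space_vgroup)
  have distr: "distr (vgroup m) (vgroup m) (vadd m a) = vgroup m" if a: "a \<in> space (vgroup m)" for a
  proof (rule measure_eqI_generator_eq[OF Int_stable_vbasis[of m]])
    show "vbasis m \<subseteq> Pow (space (vgroup m))" by (auto simp: vbasis_def vint_def)
    show "emeasure (distr (vgroup m) (vgroup m) (vadd m a)) X = emeasure (vgroup m) X"
      if "X \<in> vbasis m" for X
      using that vadd_space[of m, OF m]
      by (auto simp: vbasis_def emeasure_distr[OF meas[OF a]] pre[OF a] vint vint_sets)
    show "range (\<lambda>_::nat. vint m 0 (\<lambda>_. 0)) \<subseteq> vbasis m" using z by (auto simp: vbasis_def)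
    show "(\<Union>i::nat. vint m 0 (\<lambda>_. 0)) = space (vgroup m)" by (simp add: vint_def)
    show "emeasure (distr (vgroup m) (vgroup m) (vadd m a)) (vint m 0 (\<lambda>_. 0)) \<noteq> \<infinity>"
      by (simp add: emeasure_distr[OF meas[OF a]] pre[OF a z] vint_sets)
  qed (simp_all add: sets_vgroup_vbasis)
  have "emeasure (vgroup m) (vadd m a ` A) = emeasure (vgroup m) A"
    if a: "a \<in> space (vgroup m)" and A: "A \<in> sets (vgroup m)" for a A
  proof -
    define b where "b = vadd m (\<lambda>k. m k - a k) (\<lambda>_. 0)"
    have b: "b \<in> space (vgroup m)" unfolding b_def by (rule vadd_space[of m, OF m])
    have ab: "vadd m a (vadd m b x) = x" "vadd m b (vadd m a x) = x" if "x \<in> space (vgroup m)" for x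
    proof -
      have *: "a k < m k" "x k < m k" for k using a that by (auto simp: space_vgroup)
      have "(a k + ((m k - a k) + x k)) mod m k = x k" for k
      proof -
        have "a k + ((m k - a k) + x k) = x k + m k" using *[of k] by simp
        then show ?thesis using *[of k] by simp
      qed
      moreover have "((m k - a k) + (a k + x k)) mod m k = x k" for k
      proof -
        have "(m k - a k) + (a k + x k) = x k + m k" using *[of k] by simp
        then show ?thesis using *[of k] by simp
      qed
      ultimately show "vadd m a (vadd m b x) = x" "vadd m b (vadd m a x) = x"
        by (auto simp: vadd_def b_def mod_simps)
    qed
    have sub: "A \<subseteq> space (vgroup m)" using A by (rule sets.sets_into_space)
    have im: "vadd m a ` A = vadd m b -` A \<inter> space (vgroup m)"
    proof (intro equalityI subsetI)
      fix y assume "y \<in> vadd m a ` A"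
      then show "y \<in> vadd m b -` A \<inter> space (vgroup m)"
        using sub ab(2) vadd_space[of m, OF m] by auto
    next
      fix y assume "y \<in> vadd m b -` A \<inter> space (vgroup m)"
      then have "vadd m b y \<in> A" "y = vadd m a (vadd m b y)" using ab(1) by auto
      then show "y \<in> vadd m a ` A" by (intro image_eqI)
    qed
    have "emeasure (vgroup m) A = emeasure (distr (vgroup m) (vgroup m) (vadd m b)) A"
      by (simp add: distr[OF b])
    also have "\<dots> = emeasure (vgroup m) (vadd m a ` A)"
      unfolding im by (rule emeasure_distr[OF meas[OF b] A])
    finally show ?thesis by simp
  qed
  then show ?thesis
    unfolding normalized_haar_def topspace_vtopology
    by (intro conjI ballI sets_vgroup_borel P.emeasure_space_1)
qed

theorem normalized_haar_iff:
  assumes m: "\<And>k. 2 \<le> m k"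
  shows "normalized_haar m \<mu> \<longleftrightarrow> \<mu> = vgroup m"
proof
  assume haar: "normalized_haar m \<mu>"
  have sets: "sets \<mu> = sets (vgroup m)"
    using haar sets_vgroup_borel[of m] by (simp add: normalized_haar_def topspace_vtopology)
  have z: "(\<lambda>_. 0) \<in> space (vgroup m)" using vadd_space[of m "\<lambda>_. 0" "\<lambda>_. 0", OF m] by (simp add: vadd_def)
  show "\<mu> = vgroup m"
  proof (rule measure_eqI_generator_eq[OF Int_stable_vbasis[of m]])
    show "vbasis m \<subseteq> Pow (space (vgroup m))" by (auto simp: vbasis_def vint_def)
    show "emeasure \<mu> X = emeasure (vgroup m) X" if "X \<in> vbasis m" for X
      using that haar_vint[of m, OF m haar] haar_vint[of m "vgroup m", OF m vgroup_haar[of m, OF m]] by (auto simp: vbasis_def)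
    show "sets \<mu> = sigma_sets (space (vgroup m)) (vbasis m)"
      using sets sets_vgroup_vbasis by simp
    show "range (\<lambda>_::nat. vint m 0 (\<lambda>_. 0)) \<subseteq> vbasis m" using z by (auto simp: vbasis_def)
    show "(\<Union>i::nat. vint m 0 (\<lambda>_. 0)) = space (vgroup m)" by (simp add: vint_def)
    show "emeasure \<mu> (vint m 0 (\<lambda>_. 0)) \<noteq> \<infinity>" by (simp add: haar_vint[of m, OF m haar z])
  qed (rule sets_vgroup_vbasis)
qed (use vgroup_haar[of m, OF m] in simp)

end

theory Submission
  imports Defs
begin

text \<open>
  Summation by parts writes \<open>t\<^sub>n f\<close> as a convex combination of the Fejer means
  \<open>\<sigma>\<^sub>j f\<close>, \<open>j \<le> n\<close>, so it suffices to bound \<open>\<bar>\<sigma>\<^sub>n f\<bar> / (n + 1) powr (1 / p - 2)\<close>. If \<open>k\<close> and \<open>l\<close> are the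
  first two coordinates in which \<open>x\<close> and \<open>y\<close> differ, then \<open>n\<close> times the Fejer kernel at
  \<open>(x, y)\<close> is \<open>O(M\<^sub>k M\<^sub>l)\<close>. For \<open>n\<close> comparable to \<open>M\<^sub>N\<close> this gives
  \<open>n \<bar>\<sigma>\<^sub>n f x\<bar> \<le> C (\<Sum>s\<le>A\<le>N. M\<^sub>A M\<^sub>s \<integral>\<^bsub>V(x,A,s)\<^esub> \<bar>f\<^sub>N\<bar>)\<close>, where \<open>V(x,A,s)\<close> consists of the points that
  agree with \<open>x\<close> in the coordinates below \<open>A\<close> other than \<open>s\<close>.

  No atomic decomposition is needed: \<open>f\<^sub>N\<close> is constant on cosets of measure \<open>1 / M\<^sub>N\<close>, whence
  \<open>\<integral>\<^bsub>V\<^esub> \<bar>f\<^sub>N\<bar> \<le> M\<^sub>N powr (1 / p - 1) * (\<integral>\<^bsub>V\<^esub> f\<^sup>* powr p) powr (1 / p)\<close>, and the factor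
  \<open>M\<^sub>N powr (1 / p - 1)\<close> is exactly what the weight \<open>n (n + 1) powr (1 / p - 2)\<close> absorbs. The
  resulting bound does not depend on \<open>n\<close>, and its \<open>p\<close>-th power integrates, by Tonelli, to at most
  a constant times \<open>(\<Sum>A. (A + 1) M\<^sub>A powr (2 p - 1)) \<parallel>f\<parallel>\<^sup>p\<close>, which is finite because \<open>p < 1 / 2\<close>.
\<close>

section \<open>The Fejer kernel\<close>

text \<open>The Vilenkin function with its Rademacher factors replaced by arbitrary numbers
  \<open>w k\<close>. For \<open>w k = rademacher m k x * cnj (rademacher m k y)\<close> it gives
  the terms of the Dirichlet kernel at (x, y), so the estimates below only need \<open>w k\<close>
  to be roots of unity. The range k < i suffices because the digits of i vanish from position i
  on.\<close>

definition vchar :: "(nat \<Rightarrow> nat) \<Rightarrow> (nat \<Rightarrow> complex) \<Rightarrow> nat \<Rightarrow> complex" where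
  "vchar m w i = (\<Prod>k<i. w k ^ vdigit m i k)"

text \<open>For s = A nothing is left free and this is \<open>vint m A x\<close>; for s < A it is a
  union of \<open>m s\<close> such cosets. The relation between x and y is symmetric, which the
  Tonelli argument exploits.\<close>

definition vcyl :: "(nat \<Rightarrow> nat) \<Rightarrow> nat \<Rightarrow> nat \<Rightarrow> (nat \<Rightarrow> nat) \<Rightarrow> (nat \<Rightarrow> nat) set" where
  "vcyl m A s x = {y \<in> space (vgroup m). \<forall>i<A. i \<noteq> s \<longrightarrow> y i = x i}"

lemma vchar_0: "vchar m w 0 = 1"
  by (simp add: vchar_def)

lemma norm_vchar: "(\<And>k. cmod (w k) = 1) \<Longrightarrow> cmod (vchar m w i) = 1"
  by (simp add: vchar_def prod_norm[symmetric] norm_power)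

context
  fixes m :: "nat \<Rightarrow> nat"
  assumes m_ge_2: "\<And>k. 2 \<le> m k"
begin

lemma vbase_mono: "i \<le> j \<Longrightarrow> vbase m i \<le> vbase m j"
  using vbase_dvd[of i j m] vbase_pos[of m, OF m_ge_2] dvd_imp_le by blast

lemma power_2_le_vbase: "2 ^ A \<le> vbase m A"
proof (induction A)
  case (Suc A)
  then show ?case using mult_le_mono[OF m_ge_2[of A] Suc] by simp
qed simp

lemma vdigit_eq_0: "i < vbase m K \<Longrightarrow> K \<le> k \<Longrightarrow> vdigit m i k = 0"
  using vbase_mono[of K k] by (simp add: vdigit_def)

lemma vchar_upto:
  assumes "i < vbase m K"
  shows "vchar m w i = (\<Prod>k<K. w k ^ vdigit m i k)"
proof -
  have 0: "vdigit m i k = 0" if "\<not> (k < i \<and> k < K)" for k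
    using vdigit_zero[of m i k, OF m_ge_2] vdigit_eq_0[OF assms, of k] that by linarith
  have "vchar m w i = (\<Prod>k<max i K. w k ^ vdigit m i k)"
    unfolding vchar_def by (intro prod.mono_neutral_left) (auto simp: 0)
  also have "\<dots> = (\<Prod>k<K. w k ^ vdigit m i k)"
    by (intro prod.mono_neutral_right) (auto simp: 0)
  finally show ?thesis .
qed

lemma vilenkin_eq_vchar: "vilenkin m i x = vchar m (\<lambda>k. rademacher m k x) i"
  unfolding vilenkin_def vchar_def
  by (intro prodinf_finite) (use vdigit_zero[of m i, OF m_ge_2] in auto)

text \<open>No carry occurs: a multiple of M_K has zero digits below position K, and b has zero
  digits from K on.\<close>

lemma vdigit_add:
  assumes "b < vbase m K"
  shows "vdigit m (a * vbase m K + b) k = vdigit m (a * vbase m K) k + vdigit m b k"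
    and "vdigit m (a * vbase m K) k = 0 \<or> vdigit m b k = 0"
proof -
  have "vdigit m (a * vbase m K + b) k = vdigit m (a * vbase m K) k + vdigit m b k
    \<and> (vdigit m (a * vbase m K) k = 0 \<or> vdigit m b k = 0)"
  proof (cases "k < K")
    case True
    then obtain c where c: "vbase m K = vbase m (Suc k) * c"
      using vbase_dvd[of "Suc k" K m] by (auto elim: dvdE)
    have e: "a * vbase m K = (a * c * m k) * vbase m k"
      unfolding c by (simp add: algebra_simps)
    have "vdigit m (a * vbase m K) k = 0"
      unfolding e vdigit_def using vbase_pos[of m k, OF m_ge_2] by simp
    moreover have "vdigit m (a * vbase m K + b) k = vdigit m b k"
      unfolding e vdigit_def using vbase_pos[of m k, OF m_ge_2] by simp
    ultimately show ?thesis by simp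
  next
    case False
    then obtain c where c: "vbase m k = vbase m K * c"
      using vbase_dvd[of K k m] by (auto elim: dvdE)
    have "vdigit m b k = 0" using vdigit_eq_0[OF assms, of k] False by simp
    moreover have "vdigit m (a * vbase m K + b) k = vdigit m (a * vbase m K) k"
      unfolding c vdigit_def div_mult2_eq using vbase_pos[of m K, OF m_ge_2] assms by simp
    ultimately show ?thesis by simp
  qed
  then show "vdigit m (a * vbase m K + b) k = vdigit m (a * vbase m K) k + vdigit m b k"
    and "vdigit m (a * vbase m K) k = 0 \<or> vdigit m b k = 0" by auto
qed

lemma vchar_add:
  assumes "b < vbase m K"
  shows "vchar m w (a * vbase m K + b) = vchar m w (a * vbase m K) * vchar m w b"
proof -
  define L where "L = a * vbase m K + b"
  have L: "L < vbase m L" using vbase_gt[of m L, OF m_ge_2] .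
  then show ?thesis
    by (subst (1 2 3) vchar_upto[of _ L])
      (auto simp: L_def vdigit_add[OF assms] power_add prod.distrib)
qed

lemma vchar_digit:
  assumes "e < m l"
  shows "vchar m w (e * vbase m l) = w l ^ e"
proof -
  have "e * vbase m l < vbase m (Suc l)" using assms vbase_pos[of m l, OF m_ge_2] by simp
  then have "vchar m w (e * vbase m l) = (\<Prod>k<Suc l. w k ^ vdigit m (e * vbase m l) k)"
    by (rule vchar_upto)
  also have "\<dots> = (\<Prod>k<l. w k ^ vdigit m (e * vbase m l) k) * w l ^ e"
    using assms vbase_pos[of m l, OF m_ge_2] by (simp add: vdigit_def)
  also have "(\<Prod>k<l. w k ^ vdigit m (e * vbase m l) k) = 1"
  proof (rule prod.neutral, rule ballI)
    fix k assume "k \<in> {..<l}"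
    then have "Suc k \<le> l" by simp
    then obtain c where c: "vbase m l = vbase m (Suc k) * c"
      using vbase_dvd[of "Suc k" l m] by (auto elim: dvdE)
    have "e * vbase m l = (e * c * m k) * vbase m k" unfolding c by (simp add: algebra_simps)
    then have "e * vbase m l div vbase m k = e * c * m k" using vbase_pos[of m k, OF m_ge_2] by (metis div_mult_self_is_m)
    then have "vdigit m (e * vbase m l) k = 0" by (simp add: vdigit_def)
    then show "w k ^ vdigit m (e * vbase m l) k = 1" by simp
  qed
  finally show ?thesis by simp
qed

text \<open>The multiples of M_K below M_{l+1} are sorted by their digit e at position l. That digit
  contributes the factor \<open>w l ^ e\<close>, and summing over e gives a full geometric sum of a
  nontrivial root of unity.\<close>

lemma sum_vchar_period:
  assumes "K \<le> l" "w l ^ m l = 1" "w l \<noteq> 1" "vbase m (Suc l) = L * vbase m K"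
  shows "(\<Sum>a<L. vchar m w (a * vbase m K)) = 0"
proof -
  obtain c where c: "vbase m l = c * vbase m K"
    using vbase_dvd[OF assms(1), of m] by (metis dvdE mult.commute)
  have L: "L = m l * c" using assms(4) vbase_pos[of m K, OF m_ge_2] by (simp add: c)
  have "(\<Sum>a<L. vchar m w (a * vbase m K))
      = (\<Sum>e<m l. \<Sum>a\<in>{e * c..<e * c + c}. vchar m w (a * vbase m K))"
    unfolding L by (rule sum.nat_group[symmetric])
  also have "\<dots> = (\<Sum>e<m l. w l ^ e * (\<Sum>g<c. vchar m w (g * vbase m K)))"
  proof (rule sum.cong)
    fix e assume e: "e \<in> {..<m l}"
    have "(\<Sum>a\<in>{e * c..<e * c + c}. vchar m w (a * vbase m K))
       = (\<Sum>g<c. vchar m w ((e * c + g) * vbase m K))"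
      using sum.shift_bounds_nat_ivl[of "\<lambda>a. vchar m w (a * vbase m K)" 0 "e * c" c]
      by (simp add: atLeast0LessThan add.commute)
    also have "\<dots> = (\<Sum>g<c. w l ^ e * vchar m w (g * vbase m K))"
    proof (rule sum.cong)
      fix g assume "g \<in> {..<c}"
      then have "g * vbase m K < vbase m l" using vbase_pos[of m K, OF m_ge_2] by (simp add: c)
      then have "vchar m w (e * vbase m l + g * vbase m K) = w l ^ e * vchar m w (g * vbase m K)"
        using e by (simp add: vchar_add vchar_digit)
      then show "vchar m w ((e * c + g) * vbase m K) = w l ^ e * vchar m w (g * vbase m K)"
        by (simp add: c algebra_simps)
    qed simp
    finally show "(\<Sum>a\<in>{e * c..<e * c + c}. vchar m w (a * vbase m K))
       = w l ^ e * (\<Sum>g<c. vchar m w (g * vbase m K))" by (simp add: sum_distrib_left)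
  qed simp
  also have "\<dots> = (\<Sum>e<m l. w l ^ e) * (\<Sum>g<c. vchar m w (g * vbase m K))"
    by (simp add: sum_distrib_right)
  also have "(\<Sum>e<m l. w l ^ e) = 0"
    using geometric_sum[OF assms(3), of "m l"] assms(2) by simp
  finally show ?thesis by simp
qed

end

text \<open>Used twice over: for the characters themselves, and for the Dirichlet sums once these
  are known to factor over blocks.\<close>

lemma sum_blocks:
  fixes f g :: "nat \<Rightarrow> 'a::comm_semiring_1"
  assumes "0 < L" and "\<And>a b. b < L \<Longrightarrow> f (a * L + b) = g a * f b"
  shows "(\<Sum>j<n. f j) = (\<Sum>a<n div L. g a) * (\<Sum>b<L. f b) + g (n div L) * (\<Sum>b<n mod L. f b)"
proof -
  have shift: "(\<Sum>j\<in>{a * L..<a * L + r}. f j) = g a * (\<Sum>b<r. f b)" if "r \<le> L" for a r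
  proof -
    have "(\<Sum>j\<in>{a * L..<a * L + r}. f j) = (\<Sum>b<r. f (a * L + b))"
      using sum.shift_bounds_nat_ivl[of f 0 "a * L" r] by (simp add: atLeast0LessThan add.commute)
    also have "\<dots> = (\<Sum>b<r. g a * f b)" using that by (intro sum.cong) (auto simp: assms)
    finally show ?thesis by (simp add: sum_distrib_left)
  qed
  have "(\<Sum>j<n. f j) = (\<Sum>j<n div L * L. f j) + (\<Sum>j\<in>{n div L * L..<n div L * L + n mod L}. f j)"
    by (metis div_mult_mod_eq le_add1 lessThan_atLeast0 sum.atLeastLessThan_concat zero_le)
  also have "(\<Sum>j<n div L * L. f j) = (\<Sum>a<n div L. g a * (\<Sum>b<L. f b))"
    by (subst sum.nat_group[symmetric]) (simp add: shift)
  also have "(\<Sum>j\<in>{n div L * L..<n div L * L + n mod L}. f j) = g (n div L) * (\<Sum>b<n mod L. f b)"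
    using assms(1) by (intro shift) simp
  finally show ?thesis by (simp add: sum_distrib_right)
qed

section \<open>Dirichlet and Fejer sums at roots of unity\<close>

context
  fixes m :: "nat \<Rightarrow> nat" and w :: "nat \<Rightarrow> complex"
  assumes m_ge_2: "\<And>k. 2 \<le> m k" and w_norm: "\<And>k. cmod (w k) = 1" and w_root: "\<And>k. w k ^ m k = 1"
begin

text \<open>Complete blocks of length L = M_{l+1} / M_K cancel by \<open>sum_vchar_period\<close>;
  what remains is one incomplete block of fewer than L unimodular terms.\<close>

lemma norm_sum_vchar_le:
  assumes "K \<le> l" "w l \<noteq> 1"
  shows "cmod (\<Sum>a<B. vchar m w (a * vbase m K)) * vbase m K \<le> vbase m (Suc l)"
proof -
  obtain L where L: "vbase m (Suc l) = L * vbase m K"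
    using vbase_dvd[of K "Suc l" m] assms(1) by (metis dvdE le_SucI mult.commute)
  have Kpos: "0 < vbase m K" using vbase_pos[of m, OF m_ge_2] .
  have Lpos: "0 < L" using vbase_pos[of m "Suc l", OF m_ge_2] L by (cases L) auto
  have eq: "vchar m w ((a * L + b) * vbase m K) = vchar m w (a * vbase m (Suc l)) * vchar m w (b * vbase m K)"
    if "b < L" for a b
  proof -
    have "b * vbase m K < vbase m (Suc l)" using that Kpos unfolding L by simp
    from vchar_add[OF m_ge_2 this, of w a] show ?thesis by (simp add: L algebra_simps del: vbase.simps)
  qed
  have "(\<Sum>a<B. vchar m w (a * vbase m K)) = vchar m w (B div L * vbase m (Suc l)) * (\<Sum>b<B mod L. vchar m w (b * vbase m K))"
    by (subst sum_blocks[of L _ "\<lambda>a. vchar m w (a * vbase m (Suc l))", OF Lpos eq])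
      (simp_all add: sum_vchar_period[of m K l w L, OF m_ge_2 assms(1) w_root assms(2) L])
  also have "cmod \<dots> = cmod (\<Sum>b<B mod L. vchar m w (b * vbase m K))"
    by (simp add: norm_mult norm_vchar[of w, OF w_norm])
  also have "\<dots> \<le> (\<Sum>b<B mod L. cmod (vchar m w (b * vbase m K)))"
    by (rule norm_sum)
  also have "\<dots> = real (B mod L)" by (simp add: norm_vchar[of w, OF w_norm])
  also have "\<dots> \<le> real L" using Lpos by (simp add: less_imp_le)
  finally have "cmod (\<Sum>a<B. vchar m w (a * vbase m K)) * vbase m K \<le> real L * vbase m K"
    by (rule mult_right_mono) simp
  then show ?thesis by (simp add: L del: vbase.simps)
qed

lemma norm_dirichlet_trivial: "cmod (\<Sum>i<j. vchar m w i) \<le> j"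
  by (rule order_trans[OF norm_sum]) (simp add: norm_vchar[of w, OF w_norm])

lemma norm_dirichlet_le:
  assumes "w k \<noteq> 1"
  shows "cmod (\<Sum>i<j. vchar m w i) \<le> vbase m (Suc k)"
  using norm_sum_vchar_le[of 0 k j] assms by simp

text \<open>The range \<open>Suc n\<close> stands for j = 1, ..., n, since the term j = 0 is an
  empty sum. Removing that term first leaves n terms of modulus at most n.\<close>

lemma norm_fejer_trivial: "cmod (\<Sum>j<Suc n. \<Sum>i<j. vchar m w i) \<le> real n * real n"
proof -
  have "cmod (\<Sum>j<Suc n. \<Sum>i<j. vchar m w i) = cmod (\<Sum>j<n. \<Sum>i<Suc j. vchar m w i)"
    by (subst sum.lessThan_Suc_shift) simp
  also have "\<dots> \<le> (\<Sum>j<n. real n)"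
  proof (rule sum_norm_le)
    fix j assume "j \<in> {..<n}"
    then have "real (Suc j) \<le> real n" by simp
    with norm_dirichlet_trivial[of "Suc j"] show "cmod (\<Sum>i<Suc j. vchar m w i) \<le> real n" by linarith
  qed
  finally show ?thesis by simp
qed

lemma norm_fejer_le1:
  assumes "w k \<noteq> 1"
  shows "cmod (\<Sum>j<Suc n. \<Sum>i<j. vchar m w i) \<le> real n * vbase m (Suc k)"
proof -
  have "cmod (\<Sum>j<Suc n. \<Sum>i<j. vchar m w i) = cmod (\<Sum>j<n. \<Sum>i<Suc j. vchar m w i)"
    by (subst sum.lessThan_Suc_shift) simp
  also have "\<dots> \<le> (\<Sum>j<n. real (vbase m (Suc k)))"
    by (rule sum_norm_le) (rule norm_dirichlet_le[OF assms])
  finally show ?thesis by simp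
qed

text \<open>The Dirichlet sum D vanishes at P = M_{k+1}, so D itself factors over blocks of length
  P. A block contributes at most P^2, and the sum of the block factors is at most M_{l+1} / P
  because \<open>w l\<close> is nontrivial as well. The incomplete last block adds P^2, which is at
  most P M_{l+1}; hence the constant 2.\<close>

lemma norm_fejer_le2:
  assumes "k < l" "w k \<noteq> 1" "w l \<noteq> 1"
  shows "cmod (\<Sum>j<n. \<Sum>i<j. vchar m w i) \<le> 2 * real (vbase m (Suc k)) * real (vbase m (Suc l))"
proof -
  define P where "P = vbase m (Suc k)"
  define D where "D = (\<lambda>j. \<Sum>i<j. vchar m w i)"
  have Ppos: "0 < P" unfolding P_def using vbase_pos[of m, OF m_ge_2] .
  have D0: "D P = 0"
    using sum_vchar_period[of m 0 k w P] m_ge_2 w_root assms by (simp add: D_def P_def)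
  have eq: "D (a * P + b) = vchar m w (a * P) * D b" if "b < P" for a b
  proof -
    \<comment> \<open>The summation variable shadows the fixed \<open>a\<close> in the upper limit;
      the whole sum is multiplied by \<open>D P = 0\<close>.\<close>
    have "D (a * P + b) = (\<Sum>a<a. vchar m w (a * P)) * D P + vchar m w (a * P) * D b"
      unfolding D_def using that vchar_add[of m _ "Suc k" w, OF m_ge_2]
      by (subst sum_blocks[of P "vchar m w" "\<lambda>a. vchar m w (a * P)"]) (use Ppos in \<open>auto simp: P_def\<close>)
    then show ?thesis by (simp add: D0)
  qed
  have Db: "cmod (\<Sum>b<r. D b) \<le> real P * real P" if "r \<le> P" for r
  proof -
    have "cmod (\<Sum>b<r. D b) \<le> (\<Sum>b<r. real P)"
      unfolding D_def P_def by (rule sum_norm_le) (rule norm_dirichlet_le[OF assms(2)])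
    also have "\<dots> \<le> real P * real P" using that by (simp add: mult_right_mono)
    finally show ?thesis .
  qed
  have G: "cmod (\<Sum>a<n div P. vchar m w (a * P)) * P \<le> vbase m (Suc l)"
    unfolding P_def by (rule norm_sum_vchar_le) (use assms in auto)
  have "cmod (\<Sum>j<n. D j)
     \<le> cmod ((\<Sum>a<n div P. vchar m w (a * P)) * (\<Sum>b<P. D b)) + cmod (vchar m w (n div P * P) * (\<Sum>b<n mod P. D b))"
    by (subst sum_blocks[of P D "\<lambda>a. vchar m w (a * P)", OF Ppos eq]) (auto intro: norm_triangle_ineq)
  also have "\<dots> \<le> cmod (\<Sum>a<n div P. vchar m w (a * P)) * (real P * real P) + real P * real P"
    using Db[of P] Db[of "n mod P"] Ppos
    by (intro add_mono) (auto simp: norm_mult norm_vchar[of w, OF w_norm] intro!: mult_left_mono)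
  also have "\<dots> \<le> real (vbase m (Suc l)) * real P + real (vbase m (Suc l)) * real P"
  proof (intro add_mono)
    show "cmod (\<Sum>a<n div P. vchar m w (a * P)) * (real P * real P) \<le> real (vbase m (Suc l)) * real P"
      unfolding mult.assoc[symmetric] by (rule mult_right_mono[OF G]) simp
    show "real P * real P \<le> real (vbase m (Suc l)) * real P"
      using vbase_mono[of m "Suc k" "Suc l", OF m_ge_2] assms(1) unfolding P_def
      by (intro mult_right_mono) (auto simp del: vbase.simps)
  qed
  finally show ?thesis by (simp add: D_def P_def algebra_simps del: vbase.simps)
qed

end

section \<open>Rademacher functions, cylinders and the pointwise kernel bound\<close>

lemma rademacher_eq_cis: "rademacher m k x = cis (2 * pi * real (x k) / real (m k))"
  by (simp add: rademacher_def cis_conv_exp mult_ac)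

lemma norm_rademacher: "cmod (rademacher m k x) = 1"
  by (simp add: rademacher_eq_cis)

lemma rademacher_inj:
  assumes "x k < m k" "y k < m k" "rademacher m k x = rademacher m k y"
  shows "x k = y k"
proof -
  have "0 < m k" using assms(1) by simp
  from Complex.bij_betw_roots_unity[OF this] have "inj_on (\<lambda>j. cis (2 * pi * real j / real (m k))) {..<m k}"
    by (rule bij_betw_imp_inj_on)
  then show ?thesis using assms by (auto simp: inj_on_def rademacher_eq_cis)
qed

lemma coordinate_measurable: "(\<lambda>x. x k) \<in> measurable (vgroup m) (count_space UNIV)"
proof -
  have "(\<lambda>x. x k) \<in> measurable (vgroup m) (uniform_count_measure {..<m k})"
    unfolding vgroup_def by (rule measurable_component_singleton) simp
  then show ?thesis
    by (rule measurable_compose) (auto simp: measurable_def sets_uniform_count_measure space_uniform_count_measure)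
qed

lemma vcyl_sets: "vcyl m A s x \<in> sets (vgroup m)"
proof -
  note [measurable] = coordinate_measurable
  have "{y \<in> space (vgroup m). \<forall>i\<in>{..<A}. i \<noteq> s \<longrightarrow> y i = x i} \<in> sets (vgroup m)" by measurable
  then show ?thesis unfolding vcyl_def Ball_def lessThan_iff .
qed

lemma vint_subset_vcyl: "A \<le> N \<Longrightarrow> z \<in> vcyl m A s x \<Longrightarrow> vint m N z \<subseteq> vcyl m A s x"
  by (auto simp: vcyl_def vint_def)

context
  fixes m :: "nat \<Rightarrow> nat"
  assumes m_ge_2: "\<And>k. 2 \<le> m k"
begin

lemma m_pos: "0 < m k"
  using m_ge_2[of k] by linarith

lemma rademacher_root: "rademacher m k x ^ m k = 1"
proof -
  have "rademacher m k x ^ m k = cis (2 * pi * real (x k))"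
    using m_pos[of k] unfolding rademacher_eq_cis Complex.DeMoivre by simp
  then show ?thesis by simp
qed

lemma norm_vilenkin: "cmod (vilenkin m i x) = 1"
  by (simp add: vilenkin_eq_vchar[OF m_ge_2] norm_vchar norm_rademacher)

lemma vilenkin_mult_cnj:
  "vilenkin m i x * cnj (vilenkin m i y) = vchar m (\<lambda>k. rademacher m k x * cnj (rademacher m k y)) i"
  by (simp add: vilenkin_eq_vchar[OF m_ge_2] vchar_def power_mult_distrib prod.distrib)

lemma vilenkin_cong:
  assumes "i < vbase m N" "\<And>k. k < N \<Longrightarrow> x k = y k"
  shows "vilenkin m i x = vilenkin m i y"
  unfolding vilenkin_eq_vchar[OF m_ge_2] vchar_upto[OF m_ge_2 assms(1)]
  using assms(2) by (auto simp: rademacher_def intro!: prod.cong)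

lemma rademacher_mult_cnj_ne_1:
  assumes "x \<in> space (vgroup m)" "y \<in> space (vgroup m)" "x k \<noteq> y k"
  shows "rademacher m k x * cnj (rademacher m k y) \<noteq> 1"
proof
  assume "rademacher m k x * cnj (rademacher m k y) = 1"
  then have "rademacher m k x * (cnj (rademacher m k y) * rademacher m k y) = rademacher m k y"
    by (simp add: mult.assoc[symmetric])
  then have "rademacher m k x = rademacher m k y"
    by (simp add: complex_norm_square[symmetric] norm_rademacher mult.commute[of "cnj _"])
  with rademacher_inj[of x k m y] assms show False by (auto simp: space_vgroup)
qed

text \<open>In every case a single term of the double sum already dominates the kernel. The factor 2
  comes from \<open>norm_fejer_le2\<close>, and each passage from M_{k+1} to M_k costs a factor
  C.\<close>

lemma norm_fejer_kernel_le:
  assumes x: "x \<in> space (vgroup m)" and y: "y \<in> space (vgroup m)"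
    and C: "\<And>k. m k \<le> C" and n: "n \<le> vbase m N"
  shows "cmod (\<Sum>j=1..n. \<Sum>i<j. vilenkin m i x * cnj (vilenkin m i y))
    \<le> 2 * (real C)\<^sup>2 * (\<Sum>A\<le>N. \<Sum>s\<le>A. real (vbase m A) * real (vbase m s) * indicator (vcyl m A s x) y)"
proof -
  define w where "w = (\<lambda>k. rademacher m k x * cnj (rademacher m k y))"
  define F where "F = (\<Sum>j<Suc n. \<Sum>i<j. vchar m w i)"
  have wn: "cmod (w k) = 1" for k by (simp add: w_def norm_mult norm_rademacher)
  have wr: "w k ^ m k = 1" for k
    by (simp add: w_def power_mult_distrib rademacher_root flip: complex_cnj_power)
  have ne: "w k \<noteq> 1" if "x k \<noteq> y k" for k
    unfolding w_def by (rule rademacher_mult_cnj_ne_1[OF x y that])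
  have F: "(\<Sum>j=1..n. \<Sum>i<j. vilenkin m i x * cnj (vilenkin m i y)) = F"
    unfolding vilenkin_mult_cnj F_def w_def[symmetric]
    by (subst sum.lessThan_Suc_shift) (simp add: sum.atLeast1_atMost_eq)
  have C2: "2 \<le> C" using m_ge_2[of 0] C[of 0] by linarith
  then have C1: "1 \<le> real C" by simp
  have M: "real (vbase m (Suc k)) \<le> real C * real (vbase m k)" for k
    using mult_right_mono[OF C[of k], of "vbase m k"] by (simp flip: of_nat_mult)
  have suff: ?thesis if A: "A \<le> N" "s \<le> A" "y \<in> vcyl m A s x"
    and B: "cmod F \<le> 2 * (real C)\<^sup>2 * (real (vbase m A) * real (vbase m s))" for A s
  proof -
    have "real (vbase m A) * real (vbase m s) = real (vbase m A) * real (vbase m s) * indicator (vcyl m A s x) y"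
      using A by simp
    also have "\<dots> \<le> (\<Sum>s\<le>A. real (vbase m A) * real (vbase m s) * indicator (vcyl m A s x) y)"
      by (rule member_le_sum) (use A in auto)
    also have "\<dots> \<le> (\<Sum>A\<le>N. \<Sum>s\<le>A. real (vbase m A) * real (vbase m s) * indicator (vcyl m A s x) y)"
      by (rule member_le_sum[of A "{..N}" "\<lambda>A. \<Sum>s\<le>A. real (vbase m A) * real (vbase m s) * indicator (vcyl m A s x) y"])
         (use A in \<open>auto intro!: sum_nonneg\<close>)
    finally have "2 * (real C)\<^sup>2 * (real (vbase m A) * real (vbase m s)) \<le> 2 * (real C)\<^sup>2 * \<dots>"
      by (rule mult_left_mono) simp
    with B show ?thesis unfolding F by linarith
  qed
  show ?thesis
  proof (cases "\<exists>k<N. x k \<noteq> y k")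
    \<comment> \<open>No difference below N: the trivial bound n^2 is at most M_N^2, the term A = s
      = N.\<close>
    case False
    have "cmod F \<le> real n * real n"
      unfolding F_def by (rule norm_fejer_trivial[OF m_ge_2 wn wr])
    also have "\<dots> \<le> real (vbase m N) * real (vbase m N)"
      using n by (intro mult_mono) auto
    also have "\<dots> \<le> 2 * (real C)\<^sup>2 * \<dots>"
      using mult_right_mono[of 1 "2 * (real C)\<^sup>2" "real (vbase m N) * real (vbase m N)"]
        one_le_power[OF C1, of 2] by simp
    finally show ?thesis by (intro suff[of N N]) (use False y in \<open>auto simp: vcyl_def\<close>)
  next
    case True
    define k where "k = (LEAST k. x k \<noteq> y k)"
    obtain i where i: "i < N" "x i \<noteq> y i" using True by blast
    have k: "x k \<noteq> y k" unfolding k_def by (rule LeastI[of _ i]) fact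
    have "k \<le> i" unfolding k_def by (rule Least_le) fact
    then have kN: "k < N" using i(1) by simp
    have kl: "x i = y i" if "i < k" for i using not_less_Least[OF that[unfolded k_def]] by simp
    show ?thesis
    proof (cases "\<exists>l<N. k < l \<and> x l \<noteq> y l")
      \<comment> \<open>Exactly one difference k below N: the bound n M_{k+1} is covered by the term
        A = N, s = k.\<close>
      case False
      have "cmod F \<le> real n * vbase m (Suc k)"
        unfolding F_def by (rule norm_fejer_le1[of m w, OF m_ge_2 wn wr ne[OF k]])
      also have "\<dots> \<le> real (vbase m N) * (real C * real (vbase m k))"
        using n M[of k] by (intro mult_mono) auto
      also have "\<dots> = real C * (real (vbase m N) * real (vbase m k))" by simp
      also have "\<dots> \<le> 2 * (real C)\<^sup>2 * (real (vbase m N) * real (vbase m k))"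
        using C1 by (intro mult_right_mono) (auto simp: power2_eq_square)
      finally show ?thesis
      proof (intro suff[of N k])
        show "y \<in> vcyl m N k x"
          unfolding vcyl_def using y False kl by (auto simp: nat_neq_iff)
      qed (use kN in auto)
    next
      \<comment> \<open>Two differences k < l below N, taken to be the first two: y agrees with x
        below l except at k, so the term A = l, s = k applies.\<close>
      case True
      define l where "l = (LEAST l. k < l \<and> x l \<noteq> y l)"
      obtain j where j: "j < N" "k < j \<and> x j \<noteq> y j" using True by blast
      have l: "k < l \<and> x l \<noteq> y l" unfolding l_def by (rule LeastI[of _ j]) fact
      have "l \<le> j" unfolding l_def by (rule Least_le) fact
      then have lN: "l < N" using j(1) by simp
      have ll: "x i = y i" if "i < l" "k < i" for i
        using not_less_Least[OF that(1)[unfolded l_def]] that(2) by simp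
      have "cmod F \<le> 2 * real (vbase m (Suc k)) * real (vbase m (Suc l))"
        unfolding F_def by (rule norm_fejer_le2[of m w, OF m_ge_2 wn wr conjunct1[OF l] ne[OF k] ne[OF conjunct2[OF l]]])
      also have "\<dots> \<le> 2 * (real C * real (vbase m k)) * (real C * real (vbase m l))"
        using M[of k] M[of l] by (intro mult_mono) auto
      also have "\<dots> = 2 * (real C)\<^sup>2 * (real (vbase m l) * real (vbase m k))"
        by (simp add: power2_eq_square)
      finally show ?thesis
      proof (intro suff[of l k])
        show "y \<in> vcyl m l k x"
          unfolding vcyl_def using y ll kl by (auto simp: nat_neq_iff)
      qed (use l lN in auto)
    qed
  qed
qed

section \<open>Partial sums of a martingale\<close>

text \<open>Allows coefficients to be compared when two Fourier sums agree as functions. With the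
  coordinates below N fixed and coordinate N varying, the sum becomes a polynomial of degree below
  \<open>m N\<close> in the Rademacher value, with zeros at all \<open>m N\<close>-th roots of
  unity. Its coefficients therefore vanish, and they are sums to which the induction hypothesis
  applies.\<close>

lemma vilenkin_independent:
  assumes "\<And>x. x \<in> space (vgroup m) \<Longrightarrow> (\<Sum>j<vbase m N. c j * vilenkin m j x) = 0"
    and "j < vbase m N"
  shows "c j = 0"
  using assms
proof (induction N arbitrary: c j)
  case 0
  have "(\<lambda>_. 0) \<in> space (vgroup m)" using m_pos by (simp add: space_vgroup)
  from "0.prems"(1)[OF this] "0.prems"(2) show ?case
    by (simp add: vilenkin_eq_vchar[OF m_ge_2] vchar_0)
next
  case (Suc N)
  let ?M = "vbase m N"
  have inner: "(\<Sum>b<?M. c (e * ?M + b) * vilenkin m b x) = 0"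
    if x: "x \<in> space (vgroup m)" and e: "e < m N" for x e
  proof -
    define S where "S = (\<lambda>e. \<Sum>b<?M. c (e * ?M + b) * vilenkin m b x)"
    define P where "P = (\<Sum>e<m N. monom (S e) e)"
    have "P = 0"
    proof (rule poly_eqI_degree[where A = "{z::complex. z ^ m N = 1}"])
      fix z :: complex assume "z \<in> {z. z ^ m N = 1}"
      then obtain t where t: "t < m N" "z = cis (2 * pi * real t / real (m N))"
        using Complex.bij_betw_roots_unity[OF m_pos[of N]] unfolding bij_betw_def by (auto simp: image_iff set_eq_iff)
      \<comment> \<open>Changing coordinate N realises an arbitrary root z as Rademacher value and
        leaves the Vilenkin functions of index below M_N unchanged.\<close>
      define x' where "x' = x(N := t)"
      have x': "x' \<in> space (vgroup m)" using x t by (simp add: x'_def space_vgroup)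
      have z: "rademacher m N x' = z" by (simp add: rademacher_eq_cis x'_def t)
      have "0 = (\<Sum>j<m N * ?M. c j * vilenkin m j x')" using Suc.prems(1)[OF x'] by simp
      also have "\<dots> = (\<Sum>e<m N. \<Sum>j\<in>{e * ?M..<e * ?M + ?M}. c j * vilenkin m j x')"
        by (rule sum.nat_group[symmetric])
      also have "\<dots> = (\<Sum>e<m N. S e * z ^ e)"
      proof (rule sum.cong)
        fix e assume e: "e \<in> {..<m N}"
        have "(\<Sum>j\<in>{e * ?M..<e * ?M + ?M}. c j * vilenkin m j x') = (\<Sum>b<?M. c (e * ?M + b) * vilenkin m (e * ?M + b) x')"
          using sum.shift_bounds_nat_ivl[of "\<lambda>j. c j * vilenkin m j x'" 0 "e * ?M" ?M]
          by (simp add: atLeast0LessThan add.commute)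
        also have "\<dots> = (\<Sum>b<?M. c (e * ?M + b) * vilenkin m b x * z ^ e)"
        proof (rule sum.cong)
          fix b assume "b \<in> {..<?M}"
          then have b: "b < ?M" by simp
          have "vilenkin m (e * ?M + b) x' = z ^ e * vilenkin m b x'"
            using e by (simp add: vilenkin_eq_vchar[OF m_ge_2] vchar_add[OF m_ge_2 b] vchar_digit[OF m_ge_2] z)
          also have "vilenkin m b x' = vilenkin m b x"
            by (rule vilenkin_cong[OF b]) (simp add: x'_def)
          finally show "c (e * ?M + b) * vilenkin m (e * ?M + b) x' = c (e * ?M + b) * vilenkin m b x * z ^ e"
            by simp
        qed simp
        finally show "(\<Sum>j\<in>{e * ?M..<e * ?M + ?M}. c j * vilenkin m j x') = S e * z ^ e"
          by (simp add: S_def sum_distrib_right)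
      qed simp
      finally show "poly P z = poly 0 z" by (simp add: P_def poly_sum poly_monom)
    next
      have "degree P \<le> m N - 1"
        unfolding P_def by (rule degree_sum_le) (auto intro: order_trans[OF degree_monom_le])
      then show "degree P < card {z::complex. z ^ m N = 1}"
        using m_pos[of N] card_roots_unity_eq[of "m N"] by simp
    qed (use m_pos[of N] card_roots_unity_eq[of "m N"] in simp)
    then have "coeff P e = 0" by simp
    then have "S e = 0" using e by (simp add: P_def coeff_sum coeff_monom)
    then show ?thesis by (simp add: S_def)
  qed
  have "c ((j div ?M) * ?M + j mod ?M) = 0"
  proof (rule Suc.IH[of "\<lambda>b. c ((j div ?M) * ?M + b)" "j mod ?M"])
    have "j div ?M < m N" using Suc.prems(2) by (simp add: less_mult_imp_div_less)
    then show "(\<Sum>b<?M. c ((j div ?M) * ?M + b) * vilenkin m b x) = 0" if "x \<in> space (vgroup m)" for x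
      using inner[OF that] by simp
  qed (use vbase_pos[of m, OF m_ge_2] in simp)
  then show ?case by (simp only: div_mult_mod_eq)
qed

text \<open>From k = N on, all \<open>f k\<close> have the same partial sum of order M_N, hence the
  same coefficients below M_N, so the defining limit is that of an eventually constant
  sequence.\<close>

lemma martingale_coeff_eq:
  assumes f: "vmartingale m f" and i: "i < vbase m N"
  shows "martingale_coeff m f i = fourier_coeff m (f N) i"
proof -
  have "fourier_coeff m (f k) i = fourier_coeff m (f N) i" if k: "N \<le> k" for k
  proof -
    have "(\<Sum>j<vbase m N. (fourier_coeff m (f k) j - fourier_coeff m (f N) j) * vilenkin m j x) = 0"
      if x: "x \<in> space (vgroup m)" for x
    proof -
      have "fourier_sum m (vbase m N) (f k) x = f N x" "fourier_sum m (vbase m N) (f N) x = f N x"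
        using f k x unfolding vmartingale_def by blast+
      then show ?thesis by (simp add: fourier_sum_def algebra_simps sum_subtractf)
    qed
    from vilenkin_independent[OF this i] show ?thesis by simp
  qed
  then have "(\<lambda>k. fourier_coeff m (f k) i) \<longlonglongrightarrow> fourier_coeff m (f N) i"
    by (intro tendsto_eventually eventually_sequentiallyI[of N])
  then show ?thesis unfolding martingale_coeff_def by (rule limI)
qed

text \<open>\<open>f N\<close> equals its own partial sum of order M_N, and the Vilenkin functions
  occurring there depend only on the coordinates below N.\<close>

lemma martingale_const:
  assumes f: "vmartingale m f" and "x \<in> space (vgroup m)" "y \<in> vint m N x"
  shows "f N y = f N x"
proof -
  have y: "y \<in> space (vgroup m)" "\<And>k. k < N \<Longrightarrow> y k = x k" using assms(3) by (auto simp: vint_def)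
  have "fourier_sum m (vbase m N) (f N) z = f N z" if "z \<in> space (vgroup m)" for z
    using f that unfolding vmartingale_def by blast
  moreover have "fourier_sum m (vbase m N) (f N) y = fourier_sum m (vbase m N) (f N) x"
    unfolding fourier_sum_def by (intro sum.cong arg_cong2[where f = "(*)"] vilenkin_cong[of _ N]) (auto simp: y)
  ultimately show ?thesis using assms(2) y by metis
qed

lemma vilenkin_measurable [measurable]: "vilenkin m i \<in> borel_measurable (vgroup m)"
proof -
  have [measurable]: "rademacher m k \<in> borel_measurable (vgroup m)" for k
    using measurable_compose[OF coordinate_measurable[of k],
       of "\<lambda>t. exp (2 * of_real pi * \<i> * of_nat t / of_nat (m k))" borel]
    unfolding rademacher_def by simp
  have "(\<lambda>x. \<Prod>k<i. rademacher m k x ^ vdigit m i k) \<in> borel_measurable (vgroup m)"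
    by measurable
  then show ?thesis by (simp add: vilenkin_eq_vchar[OF m_ge_2, abs_def] vchar_def)
qed

lemma maximal_norlund_measurable:
  "(\<lambda>x. SUP n \<in> {1..}. ennreal (cmod (norlund_mean m q n f x) / (real n + 1) powr (1 / p - 2)))
    \<in> borel_measurable (vgroup m)"
proof -
  have [measurable]: "norlund_mean m q n f \<in> borel_measurable (vgroup m)" for n
    unfolding norlund_mean_def[abs_def] martingale_sum_def by measurable
  show ?thesis by measurable
qed

lemma integrable_mult_cnj_vilenkin:
  assumes "integrable (vgroup m) g"
  shows "integrable (vgroup m) (\<lambda>y. g y * cnj (vilenkin m i y))"
proof (rule Bochner_Integration.integrable_bound[OF assms])
  have [measurable]: "g \<in> borel_measurable (vgroup m)" using assms by simp
  have [measurable]: "cnj \<in> borel_measurable borel"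
    by (intro borel_measurable_continuous_onI continuous_intros)
  show "(\<lambda>y. g y * cnj (vilenkin m i y)) \<in> borel_measurable (vgroup m)" by measurable
qed (simp add: norm_mult norm_vilenkin)

text \<open>Up to order M_N the single integrable function \<open>f N\<close> represents the whole
  martingale.\<close>

lemma martingale_sum_eq_integral:
  assumes f: "vmartingale m f" and k: "k \<le> vbase m N"
  shows "martingale_sum m k f x
    = (LINT y|vgroup m. f N y * (\<Sum>i<k. vilenkin m i x * cnj (vilenkin m i y)))"
proof -
  have int: "integrable (vgroup m) (f N)" using f by (simp add: vmartingale_def)
  have "martingale_sum m k f x = (\<Sum>i<k. (LINT y|vgroup m. f N y * cnj (vilenkin m i y)) * vilenkin m i x)"
    unfolding martingale_sum_def using k
    by (intro sum.cong) (auto simp: martingale_coeff_eq[OF f, of _ N] fourier_coeff_def)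
  also have "\<dots> = (\<Sum>i<k. (LINT y|vgroup m. f N y * cnj (vilenkin m i y) * vilenkin m i x))"
    by simp
  also have "\<dots> = (LINT y|vgroup m. (\<Sum>i<k. f N y * cnj (vilenkin m i y) * vilenkin m i x))"
    by (rule Bochner_Integration.integral_sum[symmetric]) (simp add: integrable_mult_cnj_vilenkin[OF int])
  finally show ?thesis by (simp add: sum_distrib_left mult_ac)
qed

lemma fejer_sum_eq_integral:
  assumes f: "vmartingale m f" and n: "n \<le> vbase m N"
  shows "(\<Sum>k=1..n. martingale_sum m k f x)
    = (LINT y|vgroup m. f N y * (\<Sum>k=1..n. \<Sum>i<k. vilenkin m i x * cnj (vilenkin m i y)))"
proof -
  have int: "integrable (vgroup m) (f N)" using f by (simp add: vmartingale_def)
  define K where "K = (\<lambda>k y. \<Sum>i<k. vilenkin m i x * cnj (vilenkin m i y))"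
  have K: "integrable (vgroup m) (\<lambda>y. f N y * K k y)" for k
  proof -
    have "integrable (vgroup m) (\<lambda>y. \<Sum>i<k. vilenkin m i x * (f N y * cnj (vilenkin m i y)))"
      by (intro Bochner_Integration.integrable_sum integrable_mult_right integrable_mult_cnj_vilenkin int)
    then show ?thesis by (simp add: K_def sum_distrib_left mult_ac)
  qed
  have "(\<Sum>k=1..n. martingale_sum m k f x) = (\<Sum>k=1..n. LINT y|vgroup m. f N y * K k y)"
    unfolding K_def using n by (intro sum.cong refl martingale_sum_eq_integral[OF f]) auto
  also have "\<dots> = (LINT y|vgroup m. (\<Sum>k=1..n. f N y * K k y))"
    by (rule Bochner_Integration.integral_sum[symmetric]) (rule K)
  finally show ?thesis by (simp only: K_def sum_distrib_left)
qed

lemma emeasure_vint: "x \<in> space (vgroup m) \<Longrightarrow> emeasure (vgroup m) (vint m n x) = ennreal (1 / real (vbase m n))"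
  by (rule haar_vint[OF m_ge_2 vgroup_haar[of m, OF m_ge_2]])

lemma norm_fejer_sum_le:
  assumes f: "vmartingale m f" and x: "x \<in> space (vgroup m)"
    and C: "\<And>k. m k \<le> C" and n: "n \<le> vbase m N"
  shows "cmod (\<Sum>k=1..n. martingale_sum m k f x) \<le> 2 * (real C)\<^sup>2 * (\<Sum>A\<le>N. \<Sum>s\<le>A.
     real (vbase m A) * real (vbase m s) * (LINT y|vgroup m. cmod (f N y) * indicator (vcyl m A s x) y))"
proof -
  have int: "integrable (vgroup m) (f N)" using f by (simp add: vmartingale_def)
  have int': "integrable (vgroup m) (\<lambda>y. cmod (f N y) * indicator (vcyl m A s x) y)" for A s
    using int by (intro integrable_real_mult_indicator vcyl_sets integrable_norm)
  let ?K = "\<lambda>y. 2 * (real C)\<^sup>2 * (\<Sum>A\<le>N. \<Sum>s\<le>A. real (vbase m A) * real (vbase m s) * (cmod (f N y) * indicator (vcyl m A s x) y))"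
  have "cmod (\<Sum>k=1..n. martingale_sum m k f x) \<le> (LINT y|vgroup m. ?K y)"
    unfolding fejer_sum_eq_integral[OF f n]
  proof (rule order_trans[OF integral_norm_bound integral_mono'])
    show "integrable (vgroup m) ?K" by (intro integrable_mult_right Bochner_Integration.integrable_sum int')
    fix y assume y: "y \<in> space (vgroup m)"
    show "cmod (f N y * (\<Sum>k=1..n. \<Sum>i<k. vilenkin m i x * cnj (vilenkin m i y))) \<le> ?K y"
    proof -
      define K where "K = (\<Sum>k=1..n. \<Sum>i<k. vilenkin m i x * cnj (vilenkin m i y))"
      have "cmod (f N y) * cmod K \<le> cmod (f N y) * (2 * (real C)\<^sup>2
          * (\<Sum>A\<le>N. \<Sum>s\<le>A. real (vbase m A) * real (vbase m s) * indicator (vcyl m A s x) y))"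
        unfolding K_def by (intro mult_left_mono norm_fejer_kernel_le[OF x y C n]) simp
      also have "\<dots> = ?K y" by (simp add: sum_distrib_left mult_ac)
      finally show ?thesis by (simp only: norm_mult K_def)
    qed
    show "0 \<le> ?K y" by (intro mult_nonneg_nonneg sum_nonneg) auto
  qed
  also have "\<dots> = 2 * (real C)\<^sup>2 * (\<Sum>A\<le>N. \<Sum>s\<le>A.
     real (vbase m A) * real (vbase m s) * (LINT y|vgroup m. cmod (f N y) * indicator (vcyl m A s x) y))"
    by (simp add: int')
  finally show ?thesis .
qed

end

section \<open>Powers and summation by parts\<close>

lemma ennreal_powr_ennreal: "0 \<le> a \<Longrightarrow> ennreal_powr (ennreal a) p = ennreal (a powr p)"
  by (simp add: ennreal_powr_def)

lemma ennreal_powr_mono: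
  assumes "0 \<le> p" "a \<le> b"
  shows "ennreal_powr a p \<le> ennreal_powr b p"
proof (cases "b = \<infinity>")
  case False
  then have "b < \<infinity>" by (simp add: top.not_eq_extremum)
  with assms have "a < \<infinity>" by (rule_tac le_less_trans)
  then show ?thesis
    using \<open>b < \<infinity>\<close> assms enn2real_mono[OF assms(2)]
    by (auto simp: ennreal_powr_def intro!: ennreal_leI powr_mono2)
qed (simp add: ennreal_powr_def)

lemma ennreal_powr_inverse:
  assumes "0 < p"
  shows "ennreal_powr (ennreal_powr a (1 / p)) p = a"
  using assms by (cases a) (auto simp: ennreal_powr_def powr_powr)

lemma ennreal_powr_mult:
  assumes "0 \<le> K" "0 < p"
  shows "ennreal_powr (ennreal K * a) p \<le> ennreal (K powr p) * ennreal_powr a p"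
proof (cases a)
  case (real r)
  have "ennreal_powr (ennreal K * a) p = ennreal_powr (ennreal (K * r)) p"
    using assms real by (simp add: ennreal_mult)
  also have "\<dots> = ennreal ((K * r) powr p)"
    by (rule ennreal_powr_ennreal) (use assms real in simp)
  also have "\<dots> = ennreal (K powr p) * ennreal_powr a p"
    using assms real by (simp add: ennreal_powr_ennreal powr_mult ennreal_mult)
  finally show ?thesis by simp
next
  case top
  show ?thesis
  proof (cases "K = 0")
    case False
    then have "K powr p > 0" by simp
    then have "ennreal (K powr p) * ennreal_powr a p = \<infinity>"
      using top by (simp add: ennreal_powr_def ennreal_mult_top)
    then show ?thesis by simp
  qed (use assms in \<open>simp add: ennreal_powr_def\<close>)
qed

lemma ennreal_powr_measurable [measurable]:
  assumes [measurable]: "g \<in> borel_measurable M"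
  shows "(\<lambda>x. ennreal_powr (g x) p) \<in> borel_measurable M"
  unfolding ennreal_powr_def by measurable

text \<open>Superadditivity of the power 1 / p, an exponent at least 1: write t^(1/p) as t * t^(1/p
  - 1) and enlarge the second factor to the power of the total. It pulls the p-th root out of the
  sum over cylinders.\<close>

lemma sum_le_sum_powr:
  fixes b :: "'a \<Rightarrow> real"
  assumes fin: "finite I" and b: "\<And>i. i \<in> I \<Longrightarrow> 0 \<le> b i" and p: "0 < p" "p \<le> 1"
  shows "(\<Sum>i\<in>I. b i powr (1 / p)) \<le> (\<Sum>i\<in>I. b i) powr (1 / p)"
proof -
  define T where "T = (\<Sum>i\<in>I. b i)"
  have T0: "0 \<le> T" unfolding T_def by (rule sum_nonneg) (rule b)
  have split: "t powr (1 / p) = t * t powr (1 / p - 1)" if "0 \<le> t" for t :: real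
    using that powr_add[of t 1 "1 / p - 1"] by (cases "t = 0") auto
  have "(\<Sum>i\<in>I. b i powr (1 / p)) \<le> (\<Sum>i\<in>I. b i * T powr (1 / p - 1))"
  proof (rule sum_mono)
    fix i assume i: "i \<in> I"
    have "b i \<le> T" unfolding T_def by (rule member_le_sum) (use fin b i in auto)
    then have "b i powr (1 / p - 1) \<le> T powr (1 / p - 1)"
      using p b[OF i] by (intro powr_mono2) auto
    then show "b i powr (1 / p) \<le> b i * T powr (1 / p - 1)"
      unfolding split[OF b[OF i]] by (intro mult_left_mono b i)
  qed
  also have "\<dots> = T powr (1 / p)" unfolding split[OF T0] by (simp add: T_def sum_distrib_right)
  finally show ?thesis by (simp add: T_def)
qed

text \<open>The increments d of q, with \<open>d 0 = q 0\<close>, sum back to q; exchanging the sums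
  then produces Fejer sums. For non-decreasing q starting at a nonnegative value all increments are
  nonnegative.\<close>

lemma norlund_summation_by_parts:
  fixes S :: "nat \<Rightarrow> complex" and q :: "nat \<Rightarrow> real"
  defines "d \<equiv> \<lambda>i. q i - (if i = 0 then 0 else q (i - 1))"
  shows "(\<Sum>k=1..n. of_real (q (n - k)) * S k) = (\<Sum>i<n. of_real (d i) * (\<Sum>k=1..n - i. S k))"
proof -
  have q: "q k = (\<Sum>i\<le>k. d i)" for k
    by (induction k) (auto simp: d_def)
  have "(\<Sum>k=1..n. of_real (q (n - k)) * S k) = (\<Sum>k=1..n. \<Sum>i\<in>{i\<in>{..<n}. i + k \<le> n}. of_real (d i) * S k)"
  proof (rule sum.cong)
    fix k assume k: "k \<in> {1..n}"
    then have "{i\<in>{..<n}. i + k \<le> n} = {..n - k}" by auto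
    then show "of_real (q (n - k)) * S k = (\<Sum>i\<in>{i\<in>{..<n}. i + k \<le> n}. of_real (d i) * S k)"
      by (simp add: q sum_distrib_right)
  qed simp
  also have "\<dots> = (\<Sum>i<n. \<Sum>k\<in>{k\<in>{1..n}. i + k \<le> n}. of_real (d i) * S k)"
    by (rule sum.swap_restrict) auto
  also have "\<dots> = (\<Sum>i<n. of_real (d i) * (\<Sum>k=1..n - i. S k))"
  proof (rule sum.cong)
    fix i assume "i \<in> {..<n}"
    then have "{k\<in>{1..n}. i + k \<le> n} = {1..n - i}" by auto
    then show "(\<Sum>k\<in>{k\<in>{1..n}. i + k \<le> n}. of_real (d i) * S k) = of_real (d i) * (\<Sum>k=1..n - i. S k)"
      by (simp add: sum_distrib_left)
  qed simp
  finally show ?thesis .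
qed

lemma norm_norlund_mean_le:
  assumes q: "mono q" "0 < q 0" and n: "1 \<le> n"
    and S: "\<And>j. 1 \<le> j \<Longrightarrow> j \<le> n \<Longrightarrow> cmod (\<Sum>k=1..j. martingale_sum m k f x) \<le> real j * B"
  shows "cmod (norlund_mean m q n f x) \<le> B"
proof -
  define d where "d = (\<lambda>i. q i - (if i = 0 then 0 else q (i - 1)))"
  have d0: "0 \<le> d i" for i using q monoD[OF q(1), of "i - 1" i] by (auto simp: d_def)
  have Qpos: "0 < norlund_weight q n"
  proof -
    have "0 < (\<Sum>k<n. q 0)" using q n by simp
    also have "\<dots> \<le> norlund_weight q n"
      unfolding norlund_weight_def by (intro sum_mono monoD[OF q(1)]) auto
    finally show ?thesis .
  qed
  \<comment> \<open>Applying summation by parts to the constant 1 shows that the weights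
    \<open>d i * real (n - i)\<close> add up to \<open>norlund_weight q n\<close>, so the mean is a
    convex combination of Fejer means.\<close>
  have "complex_of_real (\<Sum>i<n. d i * real (n - i)) = (\<Sum>k=1..n. of_real (q (n - k)) * 1)"
    unfolding norlund_summation_by_parts[of q n "\<lambda>_. 1"] by (simp add: d_def)
  also have "\<dots> = complex_of_real (\<Sum>k=1..n. q (n - k))" by simp
  also have "(\<Sum>k=1..n. q (n - k)) = norlund_weight q n"
    unfolding norlund_weight_def
    by (rule sum.reindex_bij_witness[of _ "\<lambda>k. n - k" "\<lambda>k. n - k"]) auto
  finally have Q: "(\<Sum>i<n. d i * real (n - i)) = norlund_weight q n" by (simp only: of_real_eq_iff)
  have "cmod (\<Sum>k=1..n. of_real (q (n - k)) * martingale_sum m k f x)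
      = cmod (\<Sum>i<n. of_real (d i) * (\<Sum>k=1..n - i. martingale_sum m k f x))"
    unfolding norlund_summation_by_parts[of q n "\<lambda>k. martingale_sum m k f x"] d_def ..
  also have "\<dots> \<le> (\<Sum>i<n. d i * (real (n - i) * B))"
  proof (rule sum_norm_le)
    fix i assume "i \<in> {..<n}"
    then have "cmod (\<Sum>k=1..n - i. martingale_sum m k f x) \<le> real (n - i) * B"
      by (intro S) auto
    then show "cmod (of_real (d i) * (\<Sum>k=1..n - i. martingale_sum m k f x)) \<le> d i * (real (n - i) * B)"
      using d0[of i] by (simp add: norm_mult mult_left_mono)
  qed
  also have "\<dots> = norlund_weight q n * B"
    unfolding Q[symmetric] by (simp only: sum_distrib_right mult.assoc)
  finally show ?thesis
    using Qpos by (simp add: norlund_mean_def norm_divide pos_divide_le_eq mult.commute)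
qed

section \<open>Integrals over cylinders\<close>

text \<open>For a martingale, the total mass is the p-th power of the H_p quasi-norm. Treating the
  p-th power of the maximal function as a density makes its integrals over cylinders monotone and
  additive set functions.\<close>

definition max_measure :: "(nat \<Rightarrow> nat) \<Rightarrow> real \<Rightarrow> vsequence \<Rightarrow> (nat \<Rightarrow> nat) measure" where
  "max_measure m p f = density (vgroup m) (\<lambda>y. ennreal_powr (martingale_max f y) p)"

text \<open>The full series over A, rather than a sum up to N, so that one majorant serves all n at
  once.\<close>

definition cyl_series :: "(nat \<Rightarrow> nat) \<Rightarrow> real \<Rightarrow> vsequence \<Rightarrow> (nat \<Rightarrow> nat) \<Rightarrow> ennreal" where
  "cyl_series m p f x = (\<Sum>A. \<Sum>s\<le>A. ennreal ((real (vbase m A) * real (vbase m s)) powr p)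
     * emeasure (max_measure m p f) (vcyl m A s x))"

lemma martingale_measurable:
  assumes f: "vmartingale m f"
  shows "f n \<in> borel_measurable (vgroup m)"
  using f by (auto simp: vmartingale_def intro: borel_measurable_integrable)

lemma martingale_max_measurable:
  assumes f: "vmartingale m f"
  shows "martingale_max f \<in> borel_measurable (vgroup m)"
proof -
  note [measurable] = martingale_measurable[OF f]
  show ?thesis unfolding martingale_max_def[abs_def] by measurable
qed

lemma sets_max_measure: "sets (max_measure m p f) = sets (vgroup m)"
  by (simp add: max_measure_def)

lemma space_max_measure: "space (max_measure m p f) = space (vgroup m)"
  by (simp add: max_measure_def)

lemma emeasure_max_measure:
  assumes f: "vmartingale m f" and V: "V \<in> sets (vgroup m)"
  shows "emeasure (max_measure m p f) V = (\<integral>\<^sup>+y. ennreal_powr (martingale_max f y) p * indicator V y \<partial>vgroup m)"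
proof -
  note [measurable] = martingale_max_measurable[OF f]
  show ?thesis unfolding max_measure_def using V by (intro emeasure_density) measurable
qed

context
  fixes m :: "nat \<Rightarrow> nat" and p :: real
  assumes m_ge_2: "\<And>k. 2 \<le> m k" and p: "0 < p" "p < 1 / 2"
begin

lemma finite_measure_max_measure:
  assumes f: "f \<in> Hp_space m p"
  shows "finite_measure (max_measure m p f)"
proof
  have "(\<integral>\<^sup>+y. ennreal_powr (martingale_max f y) p \<partial>vgroup m) \<noteq> \<infinity>"
    using f by (auto simp: Hp_space_def Hp_norm_def Lp_norm_def ennreal_powr_def)
  moreover have "emeasure (max_measure m p f) (space (vgroup m)) = (\<integral>\<^sup>+y. ennreal_powr (martingale_max f y) p \<partial>vgroup m)"
    using f by (subst emeasure_max_measure) (auto simp: Hp_space_def intro!: nn_integral_cong)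
  ultimately show "emeasure (max_measure m p f) (space (max_measure m p f)) \<noteq> \<infinity>"
    by (simp add: space_max_measure)
qed

lemma nn_integral_powr_le:
  assumes f: "vmartingale m f" and V: "V \<in> sets (vgroup m)"
  shows "(\<integral>\<^sup>+y. ennreal (cmod (f N y) powr p) * indicator V y \<partial>vgroup m) \<le> emeasure (max_measure m p f) V"
  unfolding emeasure_max_measure[OF assms]
proof (intro nn_integral_mono mult_right_mono)
  fix y
  have "ennreal (cmod (f N y)) \<le> martingale_max f y" unfolding martingale_max_def by (rule SUP_upper) simp
  from ennreal_powr_mono[OF _ this, of p] p show "ennreal (cmod (f N y) powr p) \<le> ennreal_powr (martingale_max f y) p"
    by (simp add: ennreal_powr_ennreal)
qed simp

lemma martingale_powr_le:
  assumes f: "f \<in> Hp_space m p" and z: "z \<in> space (vgroup m)"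
  shows "cmod (f N z) powr p \<le> real (vbase m N) * measure (max_measure m p f) (vint m N z)"
proof -
  have vm: "vmartingale m f" using f by (simp add: Hp_space_def)
  interpret nu: finite_measure "max_measure m p f" by (rule finite_measure_max_measure[OF f])
  have M: "0 < real (vbase m N)" using vbase_pos[of m, OF m_ge_2] by simp
  have "ennreal (cmod (f N z) powr p * (1 / real (vbase m N)))
      = (\<integral>\<^sup>+y. ennreal (cmod (f N z) powr p) * indicator (vint m N z) y \<partial>vgroup m)"
    using M by (subst ennreal_mult) (simp_all add: nn_integral_cmult_indicator vint_sets emeasure_vint[OF m_ge_2 z])
  also have "\<dots> = (\<integral>\<^sup>+y. ennreal (cmod (f N y) powr p) * indicator (vint m N z) y \<partial>vgroup m)"
    by (intro nn_integral_cong) (auto simp: indicator_def martingale_const[OF m_ge_2 vm z])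
  also have "\<dots> \<le> emeasure (max_measure m p f) (vint m N z)"
    by (rule nn_integral_powr_le[OF vm vint_sets])
  also have "\<dots> = ennreal (measure (max_measure m p f) (vint m N z))"
    by (rule nu.emeasure_eq_measure)
  finally show ?thesis using M by (simp add: field_simps)
qed

text \<open>
  Since \<open>f N\<close> is constant on cosets of measure \<open>1 / vbase m N\<close>, it is bounded on \<open>V\<close> by
  \<open>(vbase m N * measure \<nu> V) powr (1 / p)\<close>; hence \<open>\<bar>f N\<bar>\<close> is at most \<open>\<bar>f N\<bar> powr p\<close> times
  the power \<open>1 - p\<close> of this bound.
\<close>

lemma integral_martingale_le:
  assumes f: "f \<in> Hp_space m p" and V: "V \<in> sets (vgroup m)"
    and sat: "\<And>z. z \<in> V \<Longrightarrow> vint m N z \<subseteq> V"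
  shows "(LINT y|vgroup m. cmod (f N y) * indicator V y)
    \<le> real (vbase m N) powr (1 / p - 1) * measure (max_measure m p f) V powr (1 / p)"
proof -
  have vm: "vmartingale m f" using f by (simp add: Hp_space_def)
  interpret nu: finite_measure "max_measure m p f" by (rule finite_measure_max_measure[OF f])
  note [measurable] = martingale_measurable[OF vm] V
  define F where "F = measure (max_measure m p f) V"
  define D where "D = (real (vbase m N) * F) powr (1 / p - 1)"
  have F0: "0 \<le> F" by (simp add: F_def)
  have le: "cmod (f N z) \<le> cmod (f N z) powr p * D" if z: "z \<in> V" for z
  proof -
    have "z \<in> space (vgroup m)" using z V sets.sets_into_space by blast
    from martingale_powr_le[OF f this] have "cmod (f N z) powr p \<le> real (vbase m N) * measure (max_measure m p f) (vint m N z)" .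
    also have "\<dots> \<le> real (vbase m N) * F"
      unfolding F_def by (intro mult_left_mono nu.finite_measure_mono sat z) (auto simp: sets_max_measure V)
    finally have *: "(cmod (f N z) powr p) powr (1 / p - 1) \<le> D"
      unfolding D_def using p by (intro powr_mono2) (auto simp: field_simps)
    \<comment> \<open>The exponents add up to p + p (1 / p - 1) = 1; only the second factor is then
      replaced by its bound D.\<close>
    have "cmod (f N z) = cmod (f N z) powr p * (cmod (f N z) powr p) powr (1 / p - 1)"
      using p by (cases "f N z = 0") (auto simp: powr_powr algebra_simps simp flip: powr_add)
    also have "\<dots> \<le> cmod (f N z) powr p * D" by (intro mult_left_mono *) simp
    finally show ?thesis .
  qed
  have "(LINT y|vgroup m. cmod (f N y) * indicator V y) = enn2real (\<integral>\<^sup>+y. ennreal (cmod (f N y) * indicator V y) \<partial>vgroup m)"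
    by (rule integral_eq_nn_integral) auto
  also have "\<dots> \<le> enn2real (ennreal (D * F))"
  proof (rule enn2real_mono)
    have "(\<integral>\<^sup>+y. ennreal (cmod (f N y) * indicator V y) \<partial>vgroup m)
        \<le> (\<integral>\<^sup>+y. ennreal D * (ennreal (cmod (f N y) powr p) * indicator V y) \<partial>vgroup m)"
      using le by (intro nn_integral_mono) (auto simp: indicator_def D_def mult.commute simp flip: ennreal_mult'')
    also have "\<dots> = ennreal D * (\<integral>\<^sup>+y. ennreal (cmod (f N y) powr p) * indicator V y \<partial>vgroup m)"
      by (rule nn_integral_cmult) measurable
    also have "\<dots> \<le> ennreal D * ennreal F"
      using nn_integral_powr_le[OF vm V, of N] by (intro mult_left_mono) (auto simp: nu.emeasure_eq_measure F_def)
    finally show "(\<integral>\<^sup>+y. ennreal (cmod (f N y) * indicator V y) \<partial>vgroup m) \<le> ennreal (D * F)"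
      by (simp add: ennreal_mult'' F0)
  qed simp
  also have "\<dots> = D * F" by (simp add: D_def F0)
  also have "\<dots> = real (vbase m N) powr (1 / p - 1) * F powr (1 / p)"
    using F0 powr_add[of F 1 "1 / p - 1"] by (cases "F = 0") (auto simp: D_def powr_mult)
  finally show ?thesis by (simp add: F_def)
qed

end

section \<open>The maximal operator\<close>

context
  fixes m :: "nat \<Rightarrow> nat" and p :: real and C :: nat
  assumes m_ge_2: "\<And>k. 2 \<le> m k" and p: "0 < p" "p < 1 / 2" and C: "\<And>k. m k \<le> C"
begin

lemma C_ge_2: "2 \<le> C"
  using m_ge_2[of 0] C[of 0] by linarith

text \<open>The least N with n at most M_N works: the preceding M_{N-1} is below n, and one step
  multiplies by at most C.\<close>

lemma vbase_level:
  assumes "1 \<le> n"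
  obtains N where "n \<le> vbase m N" "vbase m N \<le> C * n"
proof -
  define N where "N = (LEAST N. n \<le> vbase m N)"
  have "n \<le> vbase m n" using vbase_gt[of m n, OF m_ge_2] by simp
  then have N: "n \<le> vbase m N" unfolding N_def by (rule LeastI)
  have "vbase m N \<le> C * n"
  proof (cases N)
    case 0
    have "1 * 1 \<le> C * n" using assms C_ge_2 by (intro mult_le_mono) auto
    then show ?thesis by (simp add: 0)
  next
    case (Suc k)
    then have "vbase m k \<le> n" using not_less_Least[of k "\<lambda>N. n \<le> vbase m N"] by (simp add: N_def)
    then show ?thesis using C[of k] by (simp add: Suc mult_le_mono)
  qed
  with N that show thesis by blast
qed

lemma norm_fejer_sum_le_series:
  assumes f: "f \<in> Hp_space m p" and x: "x \<in> space (vgroup m)" and n: "1 \<le> n"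
    and r: "cyl_series m p f x = ennreal r" "0 \<le> r"
  shows "cmod (\<Sum>k=1..n. martingale_sum m k f x)
    \<le> real n * (2 * (real C)\<^sup>2 * real C powr (1 / p - 1) * (real n + 1) powr (1 / p - 2) * r powr (1 / p))"
proof -
  have vm: "vmartingale m f" using f by (simp add: Hp_space_def)
  interpret nu: finite_measure "max_measure m p f" by (rule finite_measure_max_measure[OF m_ge_2 p f])
  obtain N where N: "n \<le> vbase m N" "vbase m N \<le> C * n" by (rule vbase_level[OF n])
  define F where "F = (\<lambda>A s. measure (max_measure m p f) (vcyl m A s x))"
  \<comment> \<open>Normalised so that \<open>b (A, s) powr (1 / p)\<close> is M_A M_s
    \<open>F A s powr (1 / p)\<close>, while the sum of all \<open>b i\<close> is a partial sum of
    \<open>cyl_series\<close>.\<close>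
  define b where "b = (\<lambda>(A, s). (real (vbase m A) * real (vbase m s)) powr p * F A s)"
  define I where "I = Sigma {..N} (\<lambda>A. {..A})"
  have b0: "0 \<le> b i" for i by (simp add: b_def F_def split: prod.split)
  have "(\<Sum>A\<le>N. \<Sum>s\<le>A. real (vbase m A) * real (vbase m s) * (LINT y|vgroup m. cmod (f N y) * indicator (vcyl m A s x) y))
     \<le> (\<Sum>A\<le>N. \<Sum>s\<le>A. real (vbase m A) * real (vbase m s) * (real (vbase m N) powr (1 / p - 1) * F A s powr (1 / p)))"
    unfolding F_def
    by (intro sum_mono mult_left_mono integral_martingale_le[OF m_ge_2 p f] vcyl_sets vint_subset_vcyl) auto
  also have "\<dots> = (\<Sum>i\<in>I. real (vbase m N) powr (1 / p - 1) * b i powr (1 / p))"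
    unfolding I_def using p
    by (subst sum.Sigma) (auto intro!: sum.cong simp: b_def powr_mult powr_powr)
  also have "\<dots> = real (vbase m N) powr (1 / p - 1) * (\<Sum>i\<in>I. b i powr (1 / p))"
    by (rule sum_distrib_left[symmetric])
  also have "\<dots> \<le> real (vbase m N) powr (1 / p - 1) * (\<Sum>i\<in>I. b i) powr (1 / p)"
    using p by (intro mult_left_mono sum_le_sum_powr) (auto simp: I_def b0)
  also have "\<dots> \<le> real (vbase m N) powr (1 / p - 1) * r powr (1 / p)"
  proof (intro mult_left_mono powr_mono2)
    have "ennreal (\<Sum>i\<in>I. b i) = (\<Sum>i\<in>I. ennreal (b i))"
      by (rule sum_ennreal[symmetric]) (rule b0)
    also have "\<dots> = (\<Sum>A\<le>N. \<Sum>s\<le>A. ennreal (b (A, s)))"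
      unfolding I_def by (subst sum.Sigma) auto
    also have "\<dots> = (\<Sum>A\<le>N. \<Sum>s\<le>A. ennreal ((real (vbase m A) * real (vbase m s)) powr p)
       * emeasure (max_measure m p f) (vcyl m A s x))"
      by (simp add: b_def F_def nu.emeasure_eq_measure ennreal_mult'')
    also have "\<dots> \<le> cyl_series m p f x"
      unfolding cyl_series_def by (rule sum_le_suminf) auto
    finally show "(\<Sum>i\<in>I. b i) \<le> r" using r by simp
  qed (use p in \<open>auto intro: sum_nonneg b0\<close>)
  finally have sum: "(\<Sum>A\<le>N. \<Sum>s\<le>A. real (vbase m A) * real (vbase m s) * (LINT y|vgroup m. cmod (f N y) * indicator (vcyl m A s x) y))
     \<le> real (vbase m N) powr (1 / p - 1) * r powr (1 / p)" .
  have p': "2 < 1 / p" using p by (simp add: field_simps)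
  \<comment> \<open>The power of M_N becomes a power of n, from which one factor n is split off for
    the normalisation of the Fejer mean. The remaining exponent 1 / p - 2 is positive, so n may be
    raised to n + 1.\<close>
  have "real (vbase m N) powr (1 / p - 1) \<le> (real C * real n) powr (1 / p - 1)"
    using N(2) p' by (intro powr_mono2) (auto simp flip: of_nat_mult)
  also have "\<dots> = real C powr (1 / p - 1) * (real n * real n powr (1 / p - 2))"
    using n powr_add[of "real n" 1 "1 / p - 2"] by (simp add: powr_mult)
  also have "\<dots> \<le> real C powr (1 / p - 1) * (real n * (real n + 1) powr (1 / p - 2))"
    using p' by (intro mult_left_mono powr_mono2) auto
  finally have "real (vbase m N) powr (1 / p - 1) * r powr (1 / p)
    \<le> real C powr (1 / p - 1) * (real n * (real n + 1) powr (1 / p - 2)) * r powr (1 / p)"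
    by (rule mult_right_mono) simp
  with sum have "2 * (real C)\<^sup>2 * (\<Sum>A\<le>N. \<Sum>s\<le>A. real (vbase m A) * real (vbase m s) * (LINT y|vgroup m. cmod (f N y) * indicator (vcyl m A s x) y))
     \<le> 2 * (real C)\<^sup>2 * (real C powr (1 / p - 1) * (real n * (real n + 1) powr (1 / p - 2)) * r powr (1 / p))"
    by (intro mult_left_mono) auto
  with norm_fejer_sum_le[OF m_ge_2 vm x C N(1)] show ?thesis by (simp add: mult_ac)
qed

lemma maximal_le_series:
  assumes f: "f \<in> Hp_space m p" and x: "x \<in> space (vgroup m)" and q: "mono q" "0 < q 0"
  shows "(SUP n \<in> {1..}. ennreal (cmod (norlund_mean m q n f x) / (real n + 1) powr (1 / p - 2)))
    \<le> ennreal (2 * (real C)\<^sup>2 * real C powr (1 / p - 1)) * ennreal_powr (cyl_series m p f x) (1 / p)"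
proof -
  define K where "K = 2 * (real C)\<^sup>2 * real C powr (1 / p - 1)"
  have K: "0 < K" using C_ge_2 by (simp add: K_def)
  show ?thesis unfolding K_def[symmetric]
  proof (cases "cyl_series m p f x")
    case (real r)
    show "(SUP n \<in> {1..}. ennreal (cmod (norlund_mean m q n f x) / (real n + 1) powr (1 / p - 2)))
        \<le> ennreal K * ennreal_powr (cyl_series m p f x) (1 / p)"
    proof (rule SUP_least)
      fix n :: nat assume n: "n \<in> {1..}"
      have p': "2 < 1 / p" using p by (simp add: field_simps)
      have "cmod (norlund_mean m q n f x) \<le> K * (real n + 1) powr (1 / p - 2) * r powr (1 / p)"
      proof (rule norm_norlund_mean_le[OF q])
        fix j assume j: "1 \<le> j" "j \<le> n"
        have "cmod (\<Sum>k=1..j. martingale_sum m k f x) \<le> real j * (K * (real j + 1) powr (1 / p - 2) * r powr (1 / p))"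
          unfolding K_def by (rule norm_fejer_sum_le_series[OF f x j(1) real(2,1)])
        \<comment> \<open>The weight increases with its index, so one bound serves all Fejer means
          with j at most n.\<close>
        also have "\<dots> \<le> real j * (K * (real n + 1) powr (1 / p - 2) * r powr (1 / p))"
          using j K p' by (intro mult_left_mono mult_right_mono powr_mono2) auto
        finally show "cmod (\<Sum>k=1..j. martingale_sum m k f x) \<le> real j * (K * (real n + 1) powr (1 / p - 2) * r powr (1 / p))" .
      qed (use n in simp)
      then have "cmod (norlund_mean m q n f x) / (real n + 1) powr (1 / p - 2) \<le> K * r powr (1 / p)"
        by (simp add: divide_le_eq mult_ac)
      then have "ennreal (cmod (norlund_mean m q n f x) / (real n + 1) powr (1 / p - 2)) \<le> ennreal (K * r powr (1 / p))"
        by (rule ennreal_leI)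
      then show "ennreal (cmod (norlund_mean m q n f x) / (real n + 1) powr (1 / p - 2))
        \<le> ennreal K * ennreal_powr (cyl_series m p f x) (1 / p)"
        using K real by (simp add: ennreal_powr_ennreal ennreal_mult)
    qed
  next
    \<comment> \<open>The right-hand side is infinite only because K is positive: in
      \<open>ennreal\<close> the product of 0 and infinity is 0.\<close>
    case top
    then have "ennreal K * ennreal_powr (cyl_series m p f x) (1 / p) = \<infinity>"
      using K by (simp add: ennreal_powr_def ennreal_mult_top)
    then show "(SUP n \<in> {1..}. ennreal (cmod (norlund_mean m q n f x) / (real n + 1) powr (1 / p - 2)))
        \<le> ennreal K * ennreal_powr (cyl_series m p f x) (1 / p)" by simp
  qed
qed

section \<open>Integration of the cylinder series\<close>

lemma emeasure_vcyl_le: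
  assumes y: "y \<in> space (vgroup m)"
  shows "emeasure (vgroup m) (vcyl m A s y) \<le> ennreal (real C / real (vbase m A))"
proof -
  have mem: "y(s := c) \<in> space (vgroup m)" if "c < m s" for c
    using y that by (simp add: space_vgroup)
  \<comment> \<open>Prescribing the free coordinate s covers the cylinder by at most C cosets of
    measure 1 / M_A.\<close>
  have "vcyl m A s y \<subseteq> (\<Union>c<m s. vint m A (y(s := c)))"
    by (auto simp: vcyl_def vint_def space_vgroup)
  then have "emeasure (vgroup m) (vcyl m A s y) \<le> emeasure (vgroup m) (\<Union>c<m s. vint m A (y(s := c)))"
    by (intro emeasure_mono sets.finite_UN) (auto simp: vint_sets)
  also have "\<dots> \<le> (\<Sum>c<m s. emeasure (vgroup m) (vint m A (y(s := c))))"
    by (intro emeasure_subadditive_finite) (auto simp: vint_sets)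
  also have "\<dots> = (\<Sum>c<m s. ennreal (1 / real (vbase m A)))"
    by (intro sum.cong refl emeasure_vint[OF m_ge_2] mem) simp
  also have "\<dots> = ennreal (real (m s) / real (vbase m A))"
    by (simp add: ennreal_of_nat_eq_real_of_nat flip: ennreal_mult)
  also have "\<dots> \<le> ennreal (real C / real (vbase m A))"
    using C[of s] by (intro ennreal_leI divide_right_mono) auto
  finally show ?thesis .
qed

lemma max_measure_vcyl:
  assumes f: "vmartingale m f"
  shows "(\<lambda>x. emeasure (max_measure m p f) (vcyl m A s x)) \<in> borel_measurable (vgroup m)"
    and "(\<integral>\<^sup>+x. emeasure (max_measure m p f) (vcyl m A s x) \<partial>vgroup m)
      \<le> ennreal (real C / real (vbase m A)) * (\<integral>\<^sup>+y. ennreal_powr (martingale_max f y) p \<partial>vgroup m)"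
proof -
  let ?M = "vgroup m"
  interpret prob_space ?M by (rule prob_space_vgroup[OF m_ge_2])
  interpret pair_sigma_finite ?M ?M ..
  note [measurable] = martingale_max_measurable[OF f]
  define h where "h = (\<lambda>y. ennreal_powr (martingale_max f y) p)"
  have [measurable]: "h \<in> borel_measurable ?M" unfolding h_def by measurable
  \<comment> \<open>By the symmetry of the cylinder relation, the sections of E in both directions
    are cylinders. Exchanging the integrals therefore replaces the \<open>max_measure\<close> of a
    cylinder around x by the Haar measure of a cylinder around y.\<close>
  define E where "E = {z \<in> space (?M \<Otimes>\<^sub>M ?M). \<forall>i\<in>{..<A}. i \<noteq> s \<longrightarrow> snd z i = fst z i}"
  have coord: "(\<lambda>x. real (x i)) \<in> borel_measurable ?M" for i
    by (rule measurable_compose[OF coordinate_measurable]) simp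
  have fst: "(\<lambda>z. real (fst z i)) \<in> borel_measurable (?M \<Otimes>\<^sub>M ?M)" for i
    by (rule measurable_compose[OF measurable_fst coord])
  have snd: "(\<lambda>z. real (snd z i)) \<in> borel_measurable (?M \<Otimes>\<^sub>M ?M)" for i
    by (rule measurable_compose[OF measurable_snd coord])
  have [measurable]: "E \<in> sets (?M \<Otimes>\<^sub>M ?M)"
    unfolding E_def
  proof (intro sets.sets_Collect_finite_All sets.sets_Collect_imp sets.sets_Collect_const)
    show "{z \<in> space (?M \<Otimes>\<^sub>M ?M). snd z i = fst z i} \<in> sets (?M \<Otimes>\<^sub>M ?M)" for i
      using borel_measurable_eq[OF snd[of i] fst[of i]] by simp
  qed simp
  have E1: "indicator (vcyl m A s x) y = (indicator E (x, y) :: ennreal)"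
   and E2: "indicator (vcyl m A s y) x = (indicator E (x, y) :: ennreal)" if "x \<in> space ?M" "y \<in> space ?M" for x y
    using that by (auto simp: E_def vcyl_def space_pair_measure indicator_def)
  have eq: "emeasure (max_measure m p f) (vcyl m A s x) = (\<integral>\<^sup>+y. h y * indicator E (x, y) \<partial>?M)"
    if x: "x \<in> space ?M" for x
    unfolding emeasure_max_measure[OF f vcyl_sets] h_def
    by (intro nn_integral_cong) (simp add: E1[OF x])
  show "(\<lambda>x. emeasure (max_measure m p f) (vcyl m A s x)) \<in> borel_measurable ?M"
    by (subst measurable_cong[OF eq]) measurable
  have "(\<integral>\<^sup>+x. emeasure (max_measure m p f) (vcyl m A s x) \<partial>?M) = (\<integral>\<^sup>+x. \<integral>\<^sup>+y. h y * indicator E (x, y) \<partial>?M \<partial>?M)"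
    by (intro nn_integral_cong eq)
  also have "\<dots> = (\<integral>\<^sup>+y. \<integral>\<^sup>+x. h y * indicator E (x, y) \<partial>?M \<partial>?M)"
    using Fubini[of "\<lambda>z. h (snd z) * indicator E z"] by simp
  also have "\<dots> \<le> (\<integral>\<^sup>+y. ennreal (real C / real (vbase m A)) * h y \<partial>?M)"
  proof (rule nn_integral_mono)
    fix y assume y: "y \<in> space ?M"
    have "(\<integral>\<^sup>+x. h y * indicator E (x, y) \<partial>?M) = (\<integral>\<^sup>+x. h y * indicator (vcyl m A s y) x \<partial>?M)"
      by (intro nn_integral_cong) (simp add: E2 y)
    also have "\<dots> = h y * emeasure ?M (vcyl m A s y)"
      by (rule nn_integral_cmult_indicator[OF vcyl_sets])
    also have "\<dots> \<le> h y * ennreal (real C / real (vbase m A))"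
      by (intro mult_left_mono emeasure_vcyl_le y) simp
    finally show "(\<integral>\<^sup>+x. h y * indicator E (x, y) \<partial>?M) \<le> ennreal (real C / real (vbase m A)) * h y"
      by (simp add: mult.commute)
  qed
  also have "\<dots> = ennreal (real C / real (vbase m A)) * (\<integral>\<^sup>+y. h y \<partial>?M)"
    by (rule nn_integral_cmult) measurable
  finally show "(\<integral>\<^sup>+x. emeasure (max_measure m p f) (vcyl m A s x) \<partial>?M)
      \<le> ennreal (real C / real (vbase m A)) * (\<integral>\<^sup>+y. ennreal_powr (martingale_max f y) p \<partial>?M)"
    by (simp add: h_def)
qed

text \<open>Each of the A + 1 values M_s is at most M_A, which leaves the power 2 p - 1 of M_A. This
  exponent is negative, so M_A may be replaced by its lower bound 2^A.\<close>

lemma sum_coeff_le: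
  "(\<Sum>s\<le>A. (real (vbase m A) * real (vbase m s)) powr p * (real C / real (vbase m A)))
    \<le> real C * (real (Suc A) * (2 powr (2 * p - 1)) ^ A)"
proof -
  define M where "M = real (vbase m A)"
  have M: "0 < M" using vbase_pos[of m, OF m_ge_2] by (simp add: M_def)
  have "(\<Sum>s\<le>A. (M * real (vbase m s)) powr p * (real C / M)) \<le> (\<Sum>s\<le>A. (M * M) powr p * (real C / M))"
    using p M vbase_mono[of m _ A, OF m_ge_2] unfolding M_def
    by (intro sum_mono mult_right_mono powr_mono2 mult_left_mono) auto
  also have "\<dots> = real C * (real (Suc A) * M powr (2 * p - 1))"
    using M by (simp add: powr_diff powr_mult field_simps flip: powr_add)
  also have "M powr (2 * p - 1) \<le> (2 ^ A) powr (2 * p - 1)"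
  proof (rule powr_mono2')
    show "2 ^ A \<le> M" using power_2_le_vbase[of m A, OF m_ge_2] unfolding M_def
      by (metis of_nat_le_iff of_nat_numeral of_nat_power)
  qed (use p in auto)
  also have "(2 ^ A) powr (2 * p - 1) = (2 powr (2 * p - 1)) ^ A"
    by (simp add: powr_powr mult.commute flip: powr_realpow)
  finally show ?thesis by (simp add: M_def mult_left_mono)
qed

lemma nn_integral_cyl_series:
  "\<exists>L\<ge>0. \<forall>f. vmartingale m f \<longrightarrow> (\<integral>\<^sup>+x. cyl_series m p f x \<partial>vgroup m)
      \<le> ennreal L * (\<integral>\<^sup>+y. ennreal_powr (martingale_max f y) p \<partial>vgroup m)"
proof -
  let ?M = "vgroup m"
  define \<rho> :: real where "\<rho> = 2 powr (2 * p - 1)"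
  have \<rho>: "0 < \<rho>" "\<rho> < 1" using p powr_less_mono[of "2 * p - 1" 0 "2 :: real"] by (auto simp: \<rho>_def)
  define c where "c = (\<lambda>A. real C * (real (Suc A) * \<rho> ^ A))"
  \<comment> \<open>Up to the factor C this is the differentiated geometric series; its ratio is
    below 1 exactly because p < 1 / 2.\<close>
  have c: "summable c" "\<And>A. 0 \<le> c A"
    using geometric_deriv_sums[of \<rho>] \<rho> unfolding c_def
    by (auto intro!: summable_mult simp del: of_nat_Suc simp: sums_iff)
  have "(\<integral>\<^sup>+x. cyl_series m p f x \<partial>?M)
      \<le> ennreal (suminf c) * (\<integral>\<^sup>+y. ennreal_powr (martingale_max f y) p \<partial>?M)"
    if f: "vmartingale m f" for f
  proof -
    define I where "I = (\<integral>\<^sup>+y. ennreal_powr (martingale_max f y) p \<partial>?M)"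
    let ?a = "\<lambda>A s. (real (vbase m A) * real (vbase m s)) powr p"
    note [measurable] = max_measure_vcyl(1)[OF f]
    have "(\<integral>\<^sup>+x. cyl_series m p f x \<partial>?M)
       = (\<Sum>A. \<integral>\<^sup>+x. (\<Sum>s\<le>A. ennreal (?a A s) * emeasure (max_measure m p f) (vcyl m A s x)) \<partial>?M)"
      unfolding cyl_series_def by (rule nn_integral_suminf) measurable
    also have "\<dots> = (\<Sum>A. \<Sum>s\<le>A. ennreal (?a A s) * (\<integral>\<^sup>+x. emeasure (max_measure m p f) (vcyl m A s x) \<partial>?M))"
      by (subst nn_integral_sum) (simp_all add: nn_integral_cmult)
    also have "\<dots> \<le> (\<Sum>A. ennreal (c A) * I)"
    proof (rule suminf_le)
      fix A
      have "(\<Sum>s\<le>A. ennreal (?a A s) * (\<integral>\<^sup>+x. emeasure (max_measure m p f) (vcyl m A s x) \<partial>?M))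
        \<le> (\<Sum>s\<le>A. ennreal (?a A s) * (ennreal (real C / real (vbase m A)) * I))"
        unfolding I_def by (intro sum_mono mult_left_mono max_measure_vcyl(2)[OF f]) auto
      also have "\<dots> = (\<Sum>s\<le>A. ennreal (?a A s * (real C / real (vbase m A))) * I)"
        by (intro sum.cong refl) (simp add: ennreal_mult mult.assoc del: times_divide_eq_right)
      also have "\<dots> = ennreal (\<Sum>s\<le>A. ?a A s * (real C / real (vbase m A))) * I"
        by (subst sum_ennreal[symmetric]) (simp_all only: sum_distrib_right, simp)
      also have "\<dots> \<le> ennreal (c A) * I"
        unfolding c_def \<rho>_def by (intro mult_right_mono ennreal_leI sum_coeff_le) simp
      finally show "(\<Sum>s\<le>A. ennreal (?a A s) * (\<integral>\<^sup>+x. emeasure (max_measure m p f) (vcyl m A s x) \<partial>?M)) \<le> ennreal (c A) * I" .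
    qed auto
    also have "\<dots> = ennreal (suminf c) * I"
      by (simp add: suminf_ennreal2 c)
    finally show ?thesis unfolding I_def .
  qed
  moreover have "0 \<le> suminf c" by (intro suminf_nonneg c)
  ultimately show ?thesis by blast
qed

end

theorem theorem4p2:
  fixes m :: "nat \<Rightarrow> nat" and q :: "nat \<Rightarrow> real" and p :: real
  assumes "\<And>k. 2 \<le> m k" and "bdd_above (range m)"
    and "\<And>k. 0 \<le> q k" and "0 < q 0"
    and "filterlim (norlund_weight q) at_top sequentially"
    and "mono q"
    and "0 < p" and "p < 1 / 2"
  shows "bounded_Hp_Lp m p
    (\<lambda>f x. SUP n \<in> {1..}. ennreal (cmod (norlund_mean m q n f x) / (real n + 1) powr (1 / p - 2)))"
proof -
  obtain C where C: "m k \<le> C" for k using assms(2) by (auto simp: bdd_above_def)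
  let ?T = "\<lambda>f x. SUP n \<in> {1..}. ennreal (cmod (norlund_mean m q n f x) / (real n + 1) powr (1 / p - 2))"
  define K where "K = 2 * (real C)\<^sup>2 * real C powr (1 / p - 1)"
  have K: "0 \<le> K" by (simp add: K_def)
  obtain L where L: "0 \<le> L" "\<And>f. vmartingale m f \<Longrightarrow> (\<integral>\<^sup>+x. cyl_series m p f x \<partial>vgroup m)
      \<le> ennreal L * (\<integral>\<^sup>+y. ennreal_powr (martingale_max f y) p \<partial>vgroup m)"
    using nn_integral_cyl_series[of m p C, OF assms(1,7,8) C] by blast
  \<comment> \<open>K is the constant of the pointwise bound and L that of the integrated series.
    Raising to the power p cancels the root in the pointwise bound, so the series can be integrated
    term by term; the root is restored at the end.\<close>
  have "Lp_norm m p (?T f) \<le> ennreal ((K powr p * L) powr (1 / p)) * Hp_norm m p f" if f: "f \<in> Hp_space m p" for f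
  proof -
    have vm: "vmartingale m f" using f by (simp add: Hp_space_def)
    have [measurable]: "cyl_series m p f \<in> borel_measurable (vgroup m)"
      using max_measure_vcyl(1)[OF assms(1,7,8) C vm] unfolding cyl_series_def[abs_def] by measurable
    have "(\<integral>\<^sup>+x. ennreal_powr (?T f x) p \<partial>vgroup m) \<le> (\<integral>\<^sup>+x. ennreal (K powr p) * cyl_series m p f x \<partial>vgroup m)"
    proof (rule nn_integral_mono)
      fix x assume x: "x \<in> space (vgroup m)"
      have "ennreal_powr (?T f x) p \<le> ennreal_powr (ennreal K * ennreal_powr (cyl_series m p f x) (1 / p)) p"
        unfolding K_def using assms(7)
        by (intro ennreal_powr_mono maximal_le_series[OF assms(1,7,8) C f x assms(6,4)]) simp
      also have "\<dots> \<le> ennreal (K powr p) * ennreal_powr (ennreal_powr (cyl_series m p f x) (1 / p)) p"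
        by (rule ennreal_powr_mult[OF K assms(7)])
      also have "\<dots> = ennreal (K powr p) * cyl_series m p f x"
        by (simp add: ennreal_powr_inverse[OF assms(7)])
      finally show "ennreal_powr (?T f x) p \<le> ennreal (K powr p) * cyl_series m p f x" .
    qed
    also have "\<dots> = ennreal (K powr p) * (\<integral>\<^sup>+x. cyl_series m p f x \<partial>vgroup m)"
      by (rule nn_integral_cmult) measurable
    also have "\<dots> \<le> ennreal (K powr p) * (ennreal L * (\<integral>\<^sup>+y. ennreal_powr (martingale_max f y) p \<partial>vgroup m))"
      by (intro mult_left_mono L vm) simp
    also have "\<dots> = ennreal (K powr p * L) * (\<integral>\<^sup>+y. ennreal_powr (martingale_max f y) p \<partial>vgroup m)"
      using L(1) by (simp add: ennreal_mult mult.assoc)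
    finally have "Lp_norm m p (?T f) \<le> ennreal_powr (ennreal (K powr p * L) * (\<integral>\<^sup>+y. ennreal_powr (martingale_max f y) p \<partial>vgroup m)) (1 / p)"
      unfolding Lp_norm_def using assms(7) by (intro ennreal_powr_mono) auto
    also have "\<dots> \<le> ennreal ((K powr p * L) powr (1 / p)) * Hp_norm m p f"
      unfolding Hp_norm_def Lp_norm_def using L(1) assms(7) by (intro ennreal_powr_mult) auto
    finally show ?thesis .
  qed
  then show ?thesis
    unfolding bounded_Hp_Lp_def
    by (intro exI[of _ "(K powr p * L) powr (1 / p)"] conjI ballI maximal_norlund_measurable[OF assms(1)]) auto
qed

end
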